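(* Let $0<\beta\le 1$, $\lambda>0$, and let $W_\beta^f(t)=N_\beta(E_f(t))$, $t\ge 0$, where $\{N_\beta(t)\}_{t\ge0}$ is the fractional Poisson process with parameters $\beta,\lambda$ and $\{E_f(t)\}_{t\ge0}$ is the inverse of a subordinator $\{D_f(t)\}_{t\ge0}$ with Bernstein function $f$, independent of $\{N_\beta(t)\}_{t\ge0}$. Then $\{W_\beta^f(t)\}_{t\ge0}$ is a renewal process with i.i.d. waiting times $\{J_n\}_{n\ge1}$ having distribution $$\mathbb{P}[J_n>t]=\mathbb{E}\big[e^{-\lambda E_\phi(t)}\big],\qquad t\ge0,$$ where $E_\phi(t)$ is the inverse subordinator corresponding to $\phi(s)=(f(s))^\beta$.
   Context: Subordinator and its inverse: $\{D_f(t)\}_{t\ge 0}$ is a nondecreasing Lévy process with $D_f(0)=0$ a.s. and $\mathbb{E}[e^{-sD_f(t)}]=e^{-tf(s)}$, $s>0$, where $f$ is the Bernstein function $f(s)=bs+\int_0^\infty(1-e^{-sx})\,\nu(dx)$, with $b\ge0$ and $\nu$ a non-negative Lévy measure on $(0,\infty)$ satisfying $\int_0^\infty (x\wedge1)\,\nu(dx)<\infty$ and $\nu(0,\infty)=\infty$ (so sample paths are a.s. strictly increasing). The inverse subordinator corresponding to $f$ is $E_f(t)=\inf\{r\ge0:D_f(r)>t\}$, $t\ge0$. Likewise $E_\phi(t)=\inf\{r\ge0:D_\phi(r)>t\}$, where $\{D_\phi(t)\}$ is a subordinator with $\mathbb{E}[e^{-sD_\phi(t)}]=e^{-t\phi(s)}$.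 Fractional Poisson process (FPP): for $0<\beta<1$, let $\{D_\beta(t)\}$ be the $\beta$-stable subordinator, $\mathbb{E}[e^{-sD_\beta(t)}]=e^{-ts^\beta}$, and $E_\beta(t)=\inf\{r\ge0: D_\beta(r)>t\}$ the inverse $\beta$-stable subordinator. The FPP is $N_\beta(t)=N_\beta(t,\lambda)=N(E_\beta(t),\lambda)$, where $\{N(t,\lambda)\}$ is a Poisson process of rate $\lambda>0$ independent of $E_\beta$. For $\beta=1$ the FPP is the Poisson process of rate $\lambda$. *)

theory Defs
  imports "HOL-Probability.Probability"
begin

text \<open>
  Processes are functions of time and sample point; only times t \<ge> 0 are relevant. Path
  properties are required almost surely. On the exceptional null set a first-passage time may fail
  to be measurable, so independence of, and expectations involving, first-passage times are taken
  in the completion of the probability space. For random variables measurable on the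
  original space this makes no difference.
\<close>

definition cadlag :: "(real \<Rightarrow> real) \<Rightarrow> bool" where
  "cadlag g \<longleftrightarrow>
     (\<forall>t\<ge>0. continuous (at_right t) g) \<and> (\<forall>t>0. \<exists>l. (g \<longlongrightarrow> l) (at_left t))"

text \<open>
  Stochastic continuity is not listed: it follows from stationary increments, the a.s. vanishing
  start and right-continuity.
\<close>

definition levy_process :: "'a measure \<Rightarrow> (real \<Rightarrow> 'a \<Rightarrow> real) \<Rightarrow> bool" where
  "levy_process M X \<longleftrightarrow>
     prob_space M \<and>
     (\<forall>t\<ge>0. X t \<in> borel_measurable M) \<and>
     (AE \<omega> in M. X 0 \<omega> = 0) \<and>
     (\<forall>(\<tau>::nat \<Rightarrow> real) n. 0 \<le> \<tau> 0 \<and> strict_mono_on {..n} \<tau> \<longrightarrow>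
        prob_space.indep_vars M (\<lambda>_. borel) (\<lambda>i \<omega>. X (\<tau> (Suc i)) \<omega> - X (\<tau> i) \<omega>) {..<n}) \<and>
     (\<forall>s\<ge>0. \<forall>t\<ge>0. distr M borel (\<lambda>\<omega>. X (s + t) \<omega> - X s \<omega>) = distr M borel (X t)) \<and>
     (AE \<omega> in M. cadlag (\<lambda>t. X t \<omega>))"

definition poisson_process :: "'a measure \<Rightarrow> real \<Rightarrow> (real \<Rightarrow> 'a \<Rightarrow> nat) \<Rightarrow> bool" where
  "poisson_process M l N \<longleftrightarrow>
     levy_process M (\<lambda>t \<omega>. real (N t \<omega>)) \<and>
     (\<forall>t>0. distr M (count_space UNIV) (N t) = measure_pmf (poisson_pmf (l * t)))"

definition subordinator :: "'a measure \<Rightarrow> (real \<Rightarrow> real) \<Rightarrow> (real \<Rightarrow> 'a \<Rightarrow> real) \<Rightarrow> bool" where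
  "subordinator M \<phi> D \<longleftrightarrow>
     levy_process M D \<and>
     (AE \<omega> in M. mono_on {0..} (\<lambda>t. D t \<omega>)) \<and>
     (\<forall>s>0. \<forall>t\<ge>0. (LINT \<omega>|M. exp (- s * D t \<omega>)) = exp (- t * \<phi> s))"

definition inverse_subordinator :: "(real \<Rightarrow> 'a \<Rightarrow> real) \<Rightarrow> real \<Rightarrow> 'a \<Rightarrow> real" where
  "inverse_subordinator D t \<omega> = Inf {r. 0 \<le> r \<and> t < D r \<omega>}"

text \<open>Measures on the open half-line are Borel measures on the real line not charging {..0}.\<close>

definition subordinator_levy_measure :: "real measure \<Rightarrow> bool" where
  "subordinator_levy_measure \<nu> \<longleftrightarrow>
     sets \<nu> = sets borel \<and>
     emeasure \<nu> {..0} = 0 \<and>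
     (\<integral>\<^sup>+x\<in>{0<..}. ennreal (min x 1) \<partial>\<nu>) < \<infinity>"

definition bernstein_fun :: "real \<Rightarrow> real measure \<Rightarrow> real \<Rightarrow> real" where
  "bernstein_fun b \<nu> s = b * s + (LINT x:{0<..}|\<nu>. 1 - exp (- s * x))"

definition indep_processes ::
  "'a measure \<Rightarrow> (real \<Rightarrow> 'a \<Rightarrow> real) \<Rightarrow> (real \<Rightarrow> 'a \<Rightarrow> real) \<Rightarrow> bool" where
  "indep_processes M X Y \<longleftrightarrow>
     prob_space.indep_var (completion M)
       (PiM {0..} (\<lambda>_. borel)) (\<lambda>\<omega>. \<lambda>t\<in>{0..}. X t \<omega>)
       (PiM {0..} (\<lambda>_. borel)) (\<lambda>\<omega>. \<lambda>t\<in>{0..}. Y t \<omega>)"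

definition fractional_poisson_process ::
  "'a measure \<Rightarrow> real \<Rightarrow> real \<Rightarrow> (real \<Rightarrow> 'a \<Rightarrow> nat) \<Rightarrow> bool" where
  "fractional_poisson_process M \<beta> l X \<longleftrightarrow>
     (if \<beta> = 1 then poisson_process M l X
      else \<exists>N D. poisson_process M l N \<and> subordinator M (\<lambda>s. s powr \<beta>) D \<and>
             indep_processes M (\<lambda>t \<omega>. real (N t \<omega>)) (inverse_subordinator D) \<and>
             (\<forall>t\<ge>0. \<forall>\<omega>\<in>space M. X t \<omega> = N (inverse_subordinator D t \<omega>) \<omega>))"

definition renewal_process :: "'a measure \<Rightarrow> (real \<Rightarrow> 'a \<Rightarrow> nat) \<Rightarrow> (nat \<Rightarrow> 'a \<Rightarrow> real) \<Rightarrow> bool" where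
  "renewal_process M W J \<longleftrightarrow>
     prob_space M \<and>
     prob_space.indep_vars M (\<lambda>_. borel) J {1..} \<and>
     (\<forall>n\<ge>1. distr M borel (J n) = distr M borel (J 1)) \<and>
     (\<forall>n\<ge>1. AE \<omega> in M. 0 < J n \<omega>) \<and>
     (AE \<omega> in M. \<forall>t\<ge>0. finite {n. 1 \<le> n \<and> (\<Sum>k=1..n. J k \<omega>) \<le> t} \<and>
        W t \<omega> = card {n. 1 \<le> n \<and> (\<Sum>k=1..n. J k \<omega>) \<le> t})"

end

theory Submission
  imports Defs
begin

text \<open>
  Let \<open>X\<close> be a renewal process with arrival times \<open>T n\<close>, independent of the inverse \<open>E\<close> of a
  subordinator \<open>D\<close> with unbounded exponent. Since \<open>T n \<le> E t\<close> iff \<open>D (T n -) \<le> t\<close>, the process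
  \<open>X (E t)\<close> has the arrival times \<open>D (T n -)\<close>. Conditionally on the \<open>T n\<close>, these are left limits of \<open>D\<close>
  at fixed times, where \<open>D\<close> is almost surely continuous, so by stationary independent increments the
  new gaps are i.i.d., and their Laplace transform at \<open>s\<close> is that of the gaps of \<open>X\<close> at \<open>f s\<close>.
  Starting from the exponential gaps of the Poisson process, one time change with exponent
  \<open>s powr \<beta>\<close> and one with \<open>f\<close> give gaps with transform \<open>l / (l + f s powr \<beta>)\<close>. This is also the
  transform of \<open>D\<^sub>\<phi>\<close> at an independent exponential time \<open>S\<close>, and \<open>D\<^sub>\<phi> (S -) > t\<close> iff \<open>S > E\<^sub>\<phi> t\<close>,
  an event of conditional probability \<open>exp (- l * E\<^sub>\<phi> t)\<close>.
\<close>

section \<open>Laplace transforms and independence\<close>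

text \<open>Independence is assumed between \<open>X\<close> and the inverse \<open>E\<close>, not
  between \<open>X\<close> and \<open>D\<close>, and on an exceptional null set \<open>E\<close> may
  fail to be measurable. So \<open>D\<close> has to be read off the path of \<open>E\<close>, over
  the completion. Such a path determines left limits of \<open>D\<close>, which is one reason why
  left limits appear throughout. "Conditionally on the arrival times" becomes Fubini for the product
  of the two path laws. The time change is proved for an arbitrary renewal process and an arbitrary
  unbounded exponent, because for \<beta> < 1 it is applied twice and the gaps are no longer
  exponential at the second application. From there on the gap law is followed only through its
  Laplace transform. The target subordinator may live on another probability space, so the
  comparison has to be one of laws. The infinite mass of \<nu> enters as divergence of
  \<open>f\<close> along the integers. This makes \<open>D\<close> unbounded, so that
  \<open>E\<close> is finite, and makes \<open>D t > 0\<close> for \<open>t > 0\<close>, so that the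
  new gaps are strictly positive.\<close>

lemma real_distribution_eqI_laplace:
  fixes \<mu> \<nu> :: "real measure"
  assumes "real_distribution \<mu>" "real_distribution \<nu>"
    and pos: "AE x in \<mu>. 0 \<le> x" "AE x in \<nu>. 0 \<le> x"
    and laplace: "\<And>s. 0 < s \<Longrightarrow> (LINT x|\<mu>. exp (- s * x)) = (LINT x|\<nu>. exp (- s * x))"
  shows "\<mu> = \<nu>"
proof -
  interpret \<mu>: real_distribution \<mu> by fact
  interpret \<nu>: real_distribution \<nu> by fact
  \<comment> \<open>The substitution \<open>y = exp (- x)\<close> moves both laws to the unit
    interval. The transform at an integer \<open>k \<ge> 1\<close> becomes the \<open>k\<close>-th
    moment, and the moment of order 0 is the total mass.\<close>
  let ?Y = "\<lambda>x::real. exp (- x)"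
  have Y_int: "integrable \<mu> (\<lambda>x. h (?Y x))" "integrable \<nu> (\<lambda>x. h (?Y x))"
    if "continuous_on UNIV h" for h :: "real \<Rightarrow> real"
  proof -
    have "compact (h ` {0..1})"
      using that by (intro compact_continuous_image) (auto intro: continuous_on_subset)
    then obtain B where B0: "\<And>y. y \<in> {0..1} \<Longrightarrow> norm (h y) \<le> B"
      using compact_imp_bounded[of "h ` {0..1}"] unfolding bounded_iff by blast
    have B: "\<bar>h (?Y x)\<bar> \<le> B" if "0 \<le> x" for x
      using B0[of "?Y x"] that by simp
    have h[measurable]: "h \<in> borel_measurable borel"
      using that by (rule borel_measurable_continuous_onI)
    show "integrable \<mu> (\<lambda>x. h (?Y x))" "integrable \<nu> (\<lambda>x. h (?Y x))"
      using pos B by (auto intro!: \<mu>.integrable_const_bound[where B=B] \<nu>.integrable_const_bound[where B=B]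
          elim!: eventually_mono)
  qed
  have pow: "(LINT x|\<mu>. ?Y x ^ k) = (LINT x|\<nu>. ?Y x ^ k)" for k
  proof (cases "k = 0")
    case True
    then show ?thesis using \<mu>.prob_space \<nu>.prob_space by simp
  next
    case False
    then show ?thesis using laplace[of "real k"] by (simp add: exp_of_nat_mult[symmetric])
  qed
  have eq: "(LINT x|\<mu>. h (?Y x)) = (LINT x|\<nu>. h (?Y x))"
    if h: "continuous_on UNIV h" for h :: "real \<Rightarrow> real"
  proof (rule ccontr)
    let ?d = "\<bar>(LINT x|\<mu>. h (?Y x)) - (LINT x|\<nu>. h (?Y x))\<bar>"
    assume "\<not> ?thesis"
    then have d: "0 < ?d / 3" by simp
    \<comment> \<open>A polynomial within a third of the supposed difference \<open>?d\<close>: the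
      two approximation errors add up to at most \<open>2 * ?d / 3\<close>, while moments force
      equal integrals of \<open>p\<close>.\<close>
    obtain p where p: "real_polynomial_function p" "\<And>y. y \<in> {0..1} \<Longrightarrow> \<bar>h y - p y\<bar> < ?d / 3"
      using Stone_Weierstrass_real_polynomial_function[of "{0..1::real}" h "?d/3"] d h
      by (metis compact_Icc continuous_on_subset subset_UNIV)
    obtain a n where a: "p = (\<lambda>x. \<Sum>i\<le>n. a i * x ^ i)"
      using p(1) real_polynomial_function_iff_sum by blast
    have p_close: "\<bar>h (?Y x) - p (?Y x)\<bar> \<le> ?d / 3" if "0 \<le> x" for x
      using p(2)[of "?Y x"] that by simp
    have pc: "continuous_on UNIV p"
      unfolding a by (intro continuous_intros)
    have close: "\<bar>(LINT x|M. h (?Y x)) - (LINT x|M. p (?Y x))\<bar> \<le> ?d / 3"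
      if "prob_space M" "AE x in M. 0 \<le> x" "\<And>h. continuous_on UNIV h \<Longrightarrow> integrable M (\<lambda>x. h (?Y x) :: real)" for M
    proof -
      interpret prob_space M by fact
      have "(LINT x|M. h (?Y x)) - (LINT x|M. p (?Y x)) = (LINT x|M. h (?Y x) - p (?Y x))"
        using that h pc by simp
      also have "\<bar>\<dots>\<bar> \<le> (LINT x|M. \<bar>h (?Y x) - p (?Y x)\<bar>)"
        by (rule integral_abs_bound)
      also have "\<dots> \<le> (LINT x|M. ?d / 3)"
        using that h pc
        by (intro integral_mono_AE integrable_abs Bochner_Integration.integrable_diff)
           (auto elim!: eventually_mono intro!: p_close simp del: le_divide_eq_numeral1)
      finally show ?thesis by (simp add: prob_space)
    qed
    have "(LINT x|\<mu>. p (?Y x)) = (LINT x|\<nu>. p (?Y x))"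
      unfolding a using Y_int(1)[of "\<lambda>x. x ^ i" for i] Y_int(2)[of "\<lambda>x. x ^ i" for i] pow
      by (simp add: continuous_on_power del: exp_minus)
    moreover have "\<bar>(LINT x|\<mu>. h (?Y x)) - (LINT x|\<mu>. p (?Y x))\<bar> \<le> ?d / 3"
      by (rule close) (use pos Y_int \<mu>.prob_space_axioms in auto)
    moreover have "\<bar>(LINT x|\<nu>. h (?Y x)) - (LINT x|\<nu>. p (?Y x))\<bar> \<le> ?d / 3"
      by (rule close) (use pos Y_int \<nu>.prob_space_axioms in auto)
    moreover have False if "p = q" "\<bar>a - p\<bar> \<le> \<bar>a - b\<bar> / 3" "\<bar>b - q\<bar> \<le> \<bar>a - b\<bar> / 3" "0 < \<bar>a - b\<bar> / 3"
      for a b p q :: real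
      using that by argo
    ultimately show False using d by blast
  qed
  \<comment> \<open>Cosine and sine are continuous test functions, so the images under
    \<open>?Y\<close> have equal characteristic functions. Afterwards \<open>- ln\<close> undoes
    \<open>?Y\<close>.\<close>
  have "char (distr \<mu> borel ?Y) = char (distr \<nu> borel ?Y)"
  proof
    fix t
    have int: "integrable M (\<lambda>x. iexp (t * ?Y x))" if "real_distribution M" for M
    proof -
      interpret real_distribution M by fact
      show ?thesis by (intro integrable_const_bound[where B=1]) auto
    qed
    have ReIm: "Re (iexp (t * y)) = cos (t * y)" "Im (iexp (t * y)) = sin (t * y)" for y
      by (auto simp: Re_exp Im_exp)
    have cont: "continuous_on UNIV (\<lambda>y::real. cos (t * y))" "continuous_on UNIV (\<lambda>y::real. sin (t * y))"
      by (intro continuous_intros)+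
    have ri: "Re (CLINT x|M. iexp (t * ?Y x)) = (LINT x|M. cos (t * ?Y x))"
      "Im (CLINT x|M. iexp (t * ?Y x)) = (LINT x|M. sin (t * ?Y x))" if "real_distribution M" for M
      using integral_Re[OF int[OF that]] integral_Im[OF int[OF that]] by (simp_all only: ReIm)
    have "(CLINT x|\<mu>. iexp (t * ?Y x)) = (CLINT x|\<nu>. iexp (t * ?Y x))"
      using eq[OF cont(1)] eq[OF cont(2)] by (intro complex_eqI) (simp_all only: ri assms(1,2))
    then show "char (distr \<mu> borel ?Y) t = char (distr \<nu> borel ?Y) t"
      unfolding char_def by (simp add: integral_distr)
  qed
  then have "distr \<mu> borel ?Y = distr \<nu> borel ?Y"
    by (intro Levy_uniqueness) (auto intro!: \<mu>.real_distribution_distr \<nu>.real_distribution_distr)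
  then have "distr (distr \<mu> borel ?Y) borel (\<lambda>y. - ln y) = distr (distr \<nu> borel ?Y) borel (\<lambda>y. - ln y)"
    by simp
  then have "distr \<mu> borel (\<lambda>x. x) = distr \<nu> borel (\<lambda>x. x)"
    by (simp add: distr_distr o_def)
  then show ?thesis
    by (simp add: distr_id2)
qed

text \<open>A finite index set lies below its maximum, and the indices missing from it receive the
  set \<open>UNIV\<close>, whose factor is 1. Initial segments are what the joint laws of successive
  gaps provide.\<close>

lemma (in prob_space) indep_vars_atLeast_oneI:
  fixes G :: "nat \<Rightarrow> 'a \<Rightarrow> real"
  assumes rv: "\<And>i. 1 \<le> i \<Longrightarrow> G i \<in> borel_measurable M"
    and prod: "\<And>n A. (\<And>i. A i \<in> sets borel) \<Longrightarrow>
      prob {\<omega>\<in>space M. \<forall>i\<in>{1..n}. G i \<omega> \<in> A i} = (\<Prod>i=1..n. prob {\<omega>\<in>space M. G i \<omega> \<in> A i})"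
  shows "indep_vars (\<lambda>_. borel) G {1..}"
  unfolding indep_vars_def2
proof (intro conjI indep_setsI)
  show "\<forall>i\<in>{1..}. random_variable borel (G i)"
    using rv by auto
  show "{G i -` A \<inter> space M |A. A \<in> sets borel} \<subseteq> events" if "i \<in> {1..}" for i
    using rv[of i] that by auto
next
  fix A J
  assume J: "J \<noteq> {}" "J \<subseteq> {1..}" "finite J"
    and A: "\<forall>j\<in>J. A j \<in> {G j -` A \<inter> space M |A. A \<in> sets borel}"
  have "\<forall>j\<in>J. \<exists>B. A j = G j -` B \<inter> space M \<and> B \<in> sets borel"
    using A by blast
  from bchoice[OF this] obtain B where B: "\<And>j. j \<in> J \<Longrightarrow> A j = G j -` B j \<inter> space M"
      "\<And>j. j \<in> J \<Longrightarrow> B j \<in> sets borel"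
    by blast
  define B' where "B' i = (if i \<in> J then B i else UNIV)" for i
  have sub: "J \<subseteq> {1..Max J}"
    using J by auto
  have "(\<Inter>j\<in>J. A j) = {\<omega>\<in>space M. \<forall>i\<in>{1..Max J}. G i \<omega> \<in> B' i}"
    using J sub B by (auto simp: B'_def)
  then have "prob (\<Inter>j\<in>J. A j) = (\<Prod>i=1..Max J. prob {\<omega>\<in>space M. G i \<omega> \<in> B' i})"
    using prod[of B' "Max J"] B by (auto simp: B'_def)
  also have "\<dots> = (\<Prod>i\<in>J. prob {\<omega>\<in>space M. G i \<omega> \<in> B' i})"
    using sub by (intro prod.mono_neutral_right) (auto simp: B'_def prob_space)
  also have "\<dots> = (\<Prod>i\<in>J. prob (A i))"
    using B by (intro prod.cong arg_cong[where f=prob]) (auto simp: B'_def)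
  finally show "prob (\<Inter>j\<in>J. A j) = (\<Prod>j\<in>J. prob (A j))" .
qed

section \<open>Path functionals\<close>

text \<open>Passage times and left limits are expressed through rational times only, so that they are
  measurable in the path. Both functionals return \<open>0\<close> when the supremum is infinite.\<close>

definition ratsup :: "(real \<Rightarrow> bool) \<Rightarrow> real" where
  "ratsup P = enn2real (SUP q\<in>{q\<in>\<rat>. 0 \<le> q}. if P q then ennreal q else 0)"

definition left_lim :: "(real \<Rightarrow> real) \<Rightarrow> real \<Rightarrow> real" where
  "left_lim d r = enn2real (SUP q\<in>{q\<in>\<rat>. 0 \<le> q}. if q < r then ennreal (d q) else 0)"

lemma countable_nonneg_rats: "countable {q::real \<in> \<rat>. 0 \<le> q}"
  by (rule countable_subset[OF _ countable_rat]) auto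

lemma ratsup_eqI:
  assumes "0 \<le> L"
    and lower: "\<And>q. q \<in> \<rat> \<Longrightarrow> 0 \<le> q \<Longrightarrow> q < L \<Longrightarrow> P q"
    and upper: "\<And>q. q \<in> \<rat> \<Longrightarrow> 0 \<le> q \<Longrightarrow> P q \<Longrightarrow> q \<le> L"
  shows "ratsup P = L"
proof -
  have "(SUP q\<in>{q\<in>\<rat>. 0 \<le> q}. if P q then ennreal q else 0) = ennreal L" (is "?S = _")
  proof (rule antisym)
    show "?S \<le> ennreal L"
      using assms by (intro SUP_least) (auto intro!: ennreal_leI)
    show "ennreal L \<le> ?S"
    proof (rule dense_le)
      fix z assume "z < ennreal L"
      then obtain y where y: "0 \<le> y" "z = ennreal y" "y < L"
        by (cases z) (auto simp: ennreal_less_iff)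
      obtain q where q: "q \<in> \<rat>" "y < q" "q < L"
        using Rats_dense_in_real[OF \<open>y < L\<close>] by auto
      have "z \<le> (if P q then ennreal q else 0)"
        using lower[of q] q y by (auto intro!: ennreal_leI)
      also have "\<dots> \<le> ?S"
        using q y by (intro SUP_upper) auto
      finally show "z \<le> ?S" .
    qed
  qed
  then show ?thesis
    unfolding ratsup_def using assms(1) by simp
qed

lemma measurable_ratsup:
  assumes "\<And>q. q \<in> \<rat> \<Longrightarrow> 0 \<le> q \<Longrightarrow> Measurable.pred M (\<lambda>\<omega>. P q \<omega>)"
  shows "(\<lambda>\<omega>. ratsup (\<lambda>q. P q \<omega>)) \<in> borel_measurable M"
proof -
  have "(\<lambda>\<omega>. SUP q\<in>{q\<in>\<rat>. 0 \<le> q}. if P q \<omega> then ennreal q else 0) \<in> borel_measurable M"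
    using assms by (intro borel_measurable_SUP countable_nonneg_rats measurable_If) auto
  then show ?thesis
    unfolding ratsup_def by simp
qed

lemma measurable_left_lim:
  assumes "\<And>q. q \<in> \<rat> \<Longrightarrow> 0 \<le> q \<Longrightarrow> (\<lambda>\<omega>. D q \<omega>) \<in> borel_measurable M" "R \<in> borel_measurable M"
  shows "(\<lambda>\<omega>. left_lim (\<lambda>q. D q \<omega>) (R \<omega>)) \<in> borel_measurable M"
proof -
  have "(\<lambda>\<omega>. SUP q\<in>{q\<in>\<rat>. 0 \<le> q}. if q < R \<omega> then ennreal (D q \<omega>) else 0) \<in> borel_measurable M"
    using assms by (intro borel_measurable_SUP countable_nonneg_rats measurable_If) auto
  then show ?thesis
    unfolding left_lim_def by simp
qed

lemma left_lim_nonneg: "0 \<le> left_lim d r"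
  by (simp add: left_lim_def)

lemma left_lim_nonpos [simp]: "r \<le> 0 \<Longrightarrow> left_lim d r = 0"
proof -
  assume "r \<le> 0"
  then have "(SUP q\<in>{q\<in>\<rat>. 0 \<le> q}. if q < r then ennreal (d q) else 0) \<le> 0"
    by (intro SUP_least) auto
  then show ?thesis
    unfolding left_lim_def by simp
qed

lemma enn2real_le_iff: "x < \<top> \<Longrightarrow> 0 \<le> t \<Longrightarrow> enn2real x \<le> t \<longleftrightarrow> x \<le> ennreal t"
  by (cases x) auto

text \<open>Rational times suffice because between \<open>u\<close> and \<open>r\<close> lies a
  rational \<open>q\<close> with \<open>d u \<le> d q\<close>. The value \<open>d r\<close> bounds
  the supremum, so \<open>enn2real\<close> does not collapse it to \<open>0\<close>.\<close>

lemma left_lim_le_iff: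
  assumes mono: "mono_on {0..} d" and "d 0 = 0" and "0 \<le> t"
  shows "left_lim d r \<le> t \<longleftrightarrow> (\<forall>u. 0 \<le> u \<longrightarrow> u < r \<longrightarrow> d u \<le> t)"
proof (cases "r \<le> 0")
  case True
  then show ?thesis using assms by auto
next
  case False
  let ?S = "SUP q\<in>{q\<in>\<rat>. 0 \<le> q}. if q < r then ennreal (d q) else 0"
  have "?S \<le> ennreal (d r)"
    using mono by (intro SUP_least) (auto intro!: ennreal_leI simp: mono_on_def)
  then have fin: "?S < \<infinity>"
    by (simp add: order_le_less_trans)
  then have "left_lim d r \<le> t \<longleftrightarrow> ?S \<le> ennreal t"
    unfolding left_lim_def using \<open>0 \<le> t\<close> fin by (intro enn2real_le_iff) simp_all
  also have "\<dots> \<longleftrightarrow> (\<forall>u. 0 \<le> u \<longrightarrow> u < r \<longrightarrow> d u \<le> t)"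
  proof
    assume S: "?S \<le> ennreal t"
    show "\<forall>u. 0 \<le> u \<longrightarrow> u < r \<longrightarrow> d u \<le> t"
    proof (intro allI impI)
      fix u :: real assume u: "0 \<le> u" "u < r"
      obtain q where q: "q \<in> \<rat>" "u < q" "q < r"
        using Rats_dense_in_real[OF \<open>u < r\<close>] by auto
      have "ennreal (d q) \<le> ?S"
        using q u by (intro SUP_upper2[of q]) auto
      from order_trans[OF this S] have "d q \<le> t"
        using \<open>0 \<le> t\<close> by simp
      moreover have "d u \<le> d q"
        using mono q u by (auto simp: mono_on_def)
      ultimately show "d u \<le> t" by simp
    qed
  next
    assume "\<forall>u. 0 \<le> u \<longrightarrow> u < r \<longrightarrow> d u \<le> t"
    then show "?S \<le> ennreal t"
      by (intro SUP_least) (auto intro!: ennreal_leI)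
  qed
  finally show ?thesis .
qed

section \<open>The Poisson process as a renewal process\<close>

lemma levy_process_prob_space: "levy_process M X \<Longrightarrow> prob_space M"
  by (simp add: levy_process_def)

lemma levy_process_measurable: "levy_process M X \<Longrightarrow> 0 \<le> t \<Longrightarrow> X t \<in> borel_measurable M"
  by (simp add: levy_process_def)

lemma levy_process_increment_distr:
  assumes "levy_process M X" "0 \<le> s" "s \<le> t"
  shows "distr M borel (\<lambda>\<omega>. X t \<omega> - X s \<omega>) = distr M borel (X (t - s))"
proof -
  have "\<forall>s\<ge>0. \<forall>t\<ge>0. distr M borel (\<lambda>\<omega>. X (s + t) \<omega> - X s \<omega>) = distr M borel (X t)"
    using assms(1) by (simp add: levy_process_def)
  from this[rule_format, of s "t - s"] show ?thesis
    using assms(2,3) by simp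
qed

lemma levy_process_increment_measure:
  assumes X: "levy_process M X" and "0 \<le> s" "s \<le> t" and A: "A \<in> sets borel"
  shows "measure M {\<omega>\<in>space M. X t \<omega> - X s \<omega> \<in> A} = measure M {\<omega>\<in>space M. X (t - s) \<omega> \<in> A}"
proof -
  have [measurable]: "X s \<in> borel_measurable M" "X t \<in> borel_measurable M" "X (t - s) \<in> borel_measurable M"
    using assms by (auto intro: levy_process_measurable)
  have *: "measure (distr M borel Y) A = measure M {\<omega>\<in>space M. Y \<omega> \<in> A}" if "Y \<in> borel_measurable M" for Y
    using that A by (subst measure_distr) (auto intro!: arg_cong[where f="measure M"])
  show ?thesis
    using levy_process_increment_distr[OF assms(1-3)]
    by (simp only: *[symmetric] borel_measurable_diff \<open>X s \<in> borel_measurable M\<close>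
        \<open>X t \<in> borel_measurable M\<close> \<open>X (t - s) \<in> borel_measurable M\<close>)
qed

lemma levy_process_increment_nonneg:
  assumes X: "levy_process M X" and pos: "\<And>t. 0 \<le> t \<Longrightarrow> AE \<omega> in M. 0 \<le> X t \<omega>"
    and st: "0 \<le> s" "s \<le> t"
  shows "AE \<omega> in M. X s \<omega> \<le> X t \<omega>"
proof -
  have [measurable]: "X s \<in> borel_measurable M" "X t \<in> borel_measurable M" "X (t - s) \<in> borel_measurable M"
    using assms by (auto intro: levy_process_measurable)
  have "AE x in distr M borel (X (t - s)). 0 \<le> x"
    using pos[of "t - s"] st by (subst AE_distr_iff) auto
  then have "AE x in distr M borel (\<lambda>\<omega>. X t \<omega> - X s \<omega>). 0 \<le> x"
    by (subst levy_process_increment_distr[OF X st])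
  then show ?thesis
    by (subst (asm) AE_distr_iff) auto
qed

text \<open>The Markov property at a fixed time: the first \<open>j\<close> increments are grouped
  into one random vector, which is independent of the single increment that follows.\<close>

lemma levy_process_indep_past:
  assumes X: "levy_process M X" and \<tau>: "0 \<le> \<tau> 0" "strict_mono_on {..Suc j} \<tau>"
    and Q: "Measurable.pred (PiM {..<j} (\<lambda>_. borel)) Q" and A: "A \<in> sets borel"
  defines "\<Delta> \<equiv> \<lambda>i \<omega>. X (\<tau> (Suc i)) \<omega> - X (\<tau> i) \<omega>"
  shows "measure M {\<omega>\<in>space M. Q (\<lambda>i\<in>{..<j}. \<Delta> i \<omega>) \<and> \<Delta> j \<omega> \<in> A} =
    measure M {\<omega>\<in>space M. Q (\<lambda>i\<in>{..<j}. \<Delta> i \<omega>)} * measure M {\<omega>\<in>space M. \<Delta> j \<omega> \<in> A}"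
proof -
  interpret prob_space M using X by (rule levy_process_prob_space)
  have "indep_vars (\<lambda>_. borel) \<Delta> {..<Suc j}"
    using X \<tau> unfolding levy_process_def \<Delta>_def by blast
  then have ind: "indep_var (PiM {..<j} (\<lambda>_. borel)) (\<lambda>\<omega>. \<lambda>i\<in>{..<j}. \<Delta> i \<omega>)
      (PiM {j} (\<lambda>_. borel)) (\<lambda>\<omega>. \<lambda>i\<in>{j}. \<Delta> i \<omega>)"
    by (rule indep_var_restrict) auto
  let ?Q = "{d \<in> space (PiM {..<j} (\<lambda>_. borel)). Q d}"
  let ?A = "(\<lambda>f. f j) -` A \<inter> space (PiM {j} (\<lambda>_. borel))"
  have Q': "?Q \<in> sets (PiM {..<j} (\<lambda>_. borel))"
    using Q by (rule predE)
  have A': "?A \<in> sets (PiM {j} (\<lambda>_. borel))"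
    using A by measurable
  note eq = indep_varD[OF ind Q' A']
  have "(\<lambda>x. (\<lambda>i\<in>{..<j}. \<Delta> i x, \<lambda>i\<in>{j}. \<Delta> i x)) -` (?Q \<times> ?A) \<inter> space M
      = {\<omega>\<in>space M. Q (\<lambda>i\<in>{..<j}. \<Delta> i \<omega>) \<and> \<Delta> j \<omega> \<in> A}"
    "(\<lambda>\<omega>. \<lambda>i\<in>{..<j}. \<Delta> i \<omega>) -` ?Q \<inter> space M = {\<omega>\<in>space M. Q (\<lambda>i\<in>{..<j}. \<Delta> i \<omega>)}"
    "(\<lambda>\<omega>. \<lambda>i\<in>{j}. \<Delta> i \<omega>) -` ?A \<inter> space M = {\<omega>\<in>space M. \<Delta> j \<omega> \<in> A}"
    by (auto simp: space_PiM)
  with eq show ?thesis by simp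
qed

text \<open>The almost sure properties of the paths in a form without limits: for integer values,
  right-continuity amounts to constancy on some \<open>{t..<b}\<close>. Unboundedness makes every
  arrival time finite.\<close>

definition counting_path :: "(real \<Rightarrow> nat) \<Rightarrow> bool" where
  "counting_path p \<longleftrightarrow> p 0 = 0 \<and> mono_on {0..} p \<and> (\<forall>t\<ge>0. \<exists>b>t. \<forall>u\<in>{t..<b}. p u = p t) \<and>
     (\<forall>n. \<exists>m::nat. n \<le> p (real m))"

text \<open>Approached from below through rational times, so that it depends on countably many
  coordinates of the path.\<close>

definition arrival :: "(real \<Rightarrow> nat) \<Rightarrow> nat \<Rightarrow> real" where
  "arrival p n = ratsup (\<lambda>q. p q < n)"

lemma arrival_0 [simp]: "arrival p 0 = 0"
  unfolding arrival_def by (rule ratsup_eqI) auto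

lemma arrival_nonneg: "0 \<le> arrival p n"
  by (simp add: arrival_def ratsup_def)

text \<open>The infimum \<open>L\<close> of the times with count at least \<open>n\<close> is
  attained, because the path is constant immediately to the right of \<open>L\<close>. Hence the
  count is below \<open>n\<close> exactly before \<open>L\<close>, and the rational supremum equals
  \<open>L\<close>.\<close>

lemma arrival_le_iff:
  assumes p: "counting_path p" and t: "0 \<le> t"
  shows "arrival p n \<le> t \<longleftrightarrow> n \<le> p t"
proof -
  define L where "L = Inf {u. 0 \<le> u \<and> n \<le> p u}"
  have mono: "p u \<le> p v" if "0 \<le> u" "u \<le> v" for u v
    using p that by (auto simp: counting_path_def mono_on_def)
  obtain m where m: "n \<le> p (real m)"
    using p unfolding counting_path_def by blast
  have ne: "{u. 0 \<le> u \<and> n \<le> p u} \<noteq> {}"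
    using m by (auto intro!: exI[of _ "real m"])
  have bdd: "bdd_below {u. 0 \<le> u \<and> n \<le> p u}"
    by (rule bdd_belowI[of _ 0]) auto
  have "0 \<le> L"
    unfolding L_def using ne by (intro cInf_greatest) auto
  obtain b where b: "b > L" "\<And>u. u \<in> {L..<b} \<Longrightarrow> p u = p L"
    using p \<open>0 \<le> L\<close> unfolding counting_path_def by meson
  obtain u where "0 \<le> u" "n \<le> p u" "u < b"
    using b(1) cInf_less_iff[OF ne bdd] unfolding L_def by auto
  moreover have "L \<le> u"
    unfolding L_def using calculation by (intro cInf_lower bdd) auto
  ultimately have "n \<le> p L"
    using b(2)[of u] by simp
  have iff: "n \<le> p u \<longleftrightarrow> L \<le> u" if "0 \<le> u" for u
  proof
    show "L \<le> u" if "n \<le> p u"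
      unfolding L_def using that \<open>0 \<le> u\<close> by (intro cInf_lower bdd) auto
    show "n \<le> p u" if "L \<le> u"
      using \<open>n \<le> p L\<close> mono[OF \<open>0 \<le> L\<close> that] by simp
  qed
  then have iff': "p u < n \<longleftrightarrow> u < L" if "0 \<le> u" for u
    unfolding not_le[symmetric] using iff[OF that] by blast
  have "arrival p n = L"
    unfolding arrival_def using \<open>0 \<le> L\<close> by (intro ratsup_eqI) (simp_all add: iff')
  then show ?thesis
    using iff t by simp
qed

lemma arrival_mono:
  assumes p: "counting_path p" and "m \<le> n"
  shows "arrival p m \<le> arrival p n"
  using arrival_le_iff[OF p arrival_nonneg, of n p n] arrival_le_iff[OF p arrival_nonneg, of m p n] assms(2)
  by simp

lemma counting_path_eq_card:
  assumes p: "counting_path p" and t: "0 \<le> t"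
  shows "finite {n. 1 \<le> n \<and> arrival p n \<le> t}" "p t = card {n. 1 \<le> n \<and> arrival p n \<le> t}"
proof -
  have eq: "{n. 1 \<le> n \<and> arrival p n \<le> t} = {1..p t}"
    unfolding arrival_le_iff[OF p t] by auto
  show "finite {n. 1 \<le> n \<and> arrival p n \<le> t}" "p t = card {n. 1 \<le> n \<and> arrival p n \<le> t}"
    unfolding eq by simp_all
qed

text \<open>The arrivals are rounded up to a grid of mesh \<open>\<delta>\<close>; the event
  \<open>grid_arrivals\<close> then only depends on the path at grid points up to \<open>j * \<delta>\<close>, which reduces the strong Markov property at
  the \<open>n\<close>-th arrival to the independence of finitely many increments. An infinite bound \<open>a i\<close> imposes
  no constraint.\<close>

definition grid_arrivals :: "real \<Rightarrow> (nat \<Rightarrow> ereal) \<Rightarrow> nat \<Rightarrow> nat \<Rightarrow> (nat \<Rightarrow> real) \<Rightarrow> bool" where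
  "grid_arrivals \<delta> a n j x \<longleftrightarrow> (\<forall>i\<in>{1..n}. \<exists>k\<in>{..j}. ereal (real k * \<delta>) < a i \<and> real i \<le> x k) \<and>
     real n \<le> x j \<and> (\<forall>k\<in>{..<j}. x k < real n)"

lemma least_grid_point:
  assumes "0 < \<delta>" "0 \<le> (s::real)"
  shows "\<exists>k. s \<le> real k * \<delta> \<and> (\<forall>i<k. real i * \<delta> < s) \<and> real k * \<delta> < s + \<delta>"
proof -
  obtain k0 where "s < real k0 * \<delta>"
    using ex_less_of_nat_mult[OF assms(1)] by blast
  then have ex: "\<exists>k. s \<le> real k * \<delta>"
    by (intro exI[of _ k0]) simp
  define k where "k = (LEAST k. s \<le> real k * \<delta>)"
  have 1: "s \<le> real k * \<delta>"
    unfolding k_def using ex by (rule LeastI_ex)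
  have 2: "real i * \<delta> < s" if "i < k" for i
    using not_less_Least[OF that[unfolded k_def]] by simp
  have "real k * \<delta> < s + \<delta>"
  proof (cases k)
    case 0
    then show ?thesis using assms by simp
  next
    case (Suc i)
    then show ?thesis using 2[of i] by (simp add: algebra_simps)
  qed
  with 1 2 show ?thesis by blast
qed

text \<open>For a fixed path the equivalences become exact once the mesh is small enough. Rounding
  up shifts an arrival to the right by less than the mesh. This preserves the strict bounds
  \<open>a i\<close> and, by constancy to the right, the counts at the \<open>n\<close>-th arrival
  and a time \<open>t\<close> after it.\<close>

lemma grid_arrivals_limit:
  assumes p: "counting_path p" and strict: "\<And>n. arrival p n < arrival p (Suc n)" and t: "0 \<le> t"
  shows "\<forall>\<^sub>F k in sequentially.
    (\<exists>j. grid_arrivals (1 / real (Suc k)) a n j (\<lambda>i. real (p (real i * (1 / real (Suc k)))))) \<longleftrightarrow>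
      (\<forall>i\<in>{1..n}. ereal (arrival p i) < a i)"
    and "\<forall>\<^sub>F k in sequentially.
    (\<exists>j. grid_arrivals (1 / real (Suc k)) a n j (\<lambda>i. real (p (real i * (1 / real (Suc k))))) \<and>
       p (real j * (1 / real (Suc k)) + t) = p (real j * (1 / real (Suc k)))) \<longleftrightarrow>
      (\<forall>i\<in>{1..n}. ereal (arrival p i) < a i) \<and> arrival p n + t < arrival p (Suc n)"
proof -
  let ?S = "arrival p"
  \<comment> \<open>Here strictness is used: if the \<open>n\<close>-th and the next arrival
    coincided, the count would jump past \<open>n\<close>.\<close>
  have pS: "p (?S n) = n" for n
    using arrival_le_iff[OF p arrival_nonneg, of n p n] arrival_le_iff[OF p arrival_nonneg, of "Suc n" p n] strict[of n]
    by simp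
  obtain b1 where b1: "b1 > ?S n" "\<And>u. u \<in> {?S n..<b1} \<Longrightarrow> p u = p (?S n)"
    using p arrival_nonneg unfolding counting_path_def by meson
  have "0 \<le> ?S n + t"
    using t arrival_nonneg[of p n] by simp
  then obtain b2 where b2: "b2 > ?S n + t" "\<And>u. u \<in> {?S n + t..<b2} \<Longrightarrow> p u = p (?S n + t)"
    using p unfolding counting_path_def by meson
  have lim: "(\<lambda>k. 1 / real (Suc k)) \<longlonglongrightarrow> 0"
    using LIMSEQ_inverse_real_of_nat by (simp add: inverse_eq_divide)
  have ev: "\<forall>\<^sub>F k in sequentially. 1 / real (Suc k) < c" if "0 < c" for c
    using order_tendstoD(2)[OF lim that] .
  have "\<forall>\<^sub>F k in sequentially. ereal (?S i) < a i \<longrightarrow> ereal (?S i + 1 / real (Suc k)) < a i" for i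
  proof (cases "a i")
    case (real r)
    show ?thesis
    proof (cases "?S i < r")
      case True
      then show ?thesis using ev[of "r - ?S i"] real by (auto elim!: eventually_mono)
    qed (use real in auto)
  qed auto
  then have "\<forall>\<^sub>F k in sequentially. \<forall>i\<in>{1..n}. ereal (?S i) < a i \<longrightarrow> ereal (?S i + 1 / real (Suc k)) < a i"
    by (intro eventually_ball_finite) auto
  then have main: "\<forall>\<^sub>F k in sequentially. 1 / real (Suc k) < b1 - ?S n \<and> 1 / real (Suc k) < b2 - (?S n + t) \<and>
      (\<forall>i\<in>{1..n}. ereal (?S i) < a i \<longrightarrow> ereal (?S i + 1 / real (Suc k)) < a i)"
    using b1(1) b2(1) by (intro eventually_conj ev) simp_all
  have key: "(\<exists>j. grid_arrivals \<delta> a n j (\<lambda>i. real (p (real i * \<delta>)))) \<longleftrightarrow> (\<forall>i\<in>{1..n}. ereal (?S i) < a i)"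
    "(\<exists>j. grid_arrivals \<delta> a n j (\<lambda>i. real (p (real i * \<delta>))) \<and> p (real j * \<delta> + t) = p (real j * \<delta>)) \<longleftrightarrow>
      (\<forall>i\<in>{1..n}. ereal (?S i) < a i) \<and> ?S n + t < ?S (Suc n)"
    if \<delta>: "0 < \<delta>" "\<delta> < b1 - ?S n" "\<delta> < b2 - (?S n + t)"
      "\<forall>i\<in>{1..n}. ereal (?S i) < a i \<longrightarrow> ereal (?S i + \<delta>) < a i" for \<delta>
  proof -
    \<comment> \<open>\<open>j\<close> is the index of the least grid point not before the
      \<open>n\<close>-th arrival, the only index that \<open>grid_arrivals\<close> admits.\<close>
    obtain j where j: "?S n \<le> real j * \<delta>" "\<And>i. i < j \<Longrightarrow> real i * \<delta> < ?S n" "real j * \<delta> < ?S n + \<delta>"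
      using least_grid_point[OF \<delta>(1) arrival_nonneg[of p n]] by blast
    have S_iff: "real i \<le> real (p (real k * \<delta>)) \<longleftrightarrow> ?S i \<le> real k * \<delta>" for i k
      using arrival_le_iff[OF p, of "real k * \<delta>" i] \<delta>(1) by simp
    have S_iff': "real (p (real k * \<delta>)) < real i \<longleftrightarrow> real k * \<delta> < ?S i" for i k
      unfolding not_le[symmetric] using S_iff[of i k] by blast
    have uniq: "j' = j" if "?S n \<le> real j' * \<delta>" "\<And>i. i < j' \<Longrightarrow> real i * \<delta> < ?S n" for j'
      using j(2)[of j'] that(2)[of j] j(1) that(1) by linarith
    have early: "(\<exists>k\<in>{..j}. ereal (real k * \<delta>) < a i \<and> ?S i \<le> real k * \<delta>) \<longleftrightarrow> ereal (?S i) < a i"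
      if i: "i \<in> {1..n}" for i
    proof
      assume "\<exists>k\<in>{..j}. ereal (real k * \<delta>) < a i \<and> ?S i \<le> real k * \<delta>"
      then obtain k where "ereal (real k * \<delta>) < a i" "?S i \<le> real k * \<delta>"
        by blast
      then show "ereal (?S i) < a i"
        using order_le_less_trans[of "ereal (?S i)" "ereal (real k * \<delta>)" "a i"] by simp
    next
      assume less: "ereal (?S i) < a i"
      obtain k where k: "?S i \<le> real k * \<delta>" "\<And>l. l < k \<Longrightarrow> real l * \<delta> < ?S i" "real k * \<delta> < ?S i + \<delta>"
        using least_grid_point[OF \<delta>(1) arrival_nonneg[of p i]] by blast
      have "?S i \<le> real j * \<delta>"
        using arrival_mono[OF p, of i n] i j(1) by simp
      then have "k \<le> j"
        using k(2)[of j] by force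
      moreover have "ereal (real k * \<delta>) < a i"
        using \<delta>(4) i less k(3) order_less_trans[of "ereal (real k * \<delta>)" "ereal (?S i + \<delta>)" "a i"] by simp
      ultimately show "\<exists>k\<in>{..j}. ereal (real k * \<delta>) < a i \<and> ?S i \<le> real k * \<delta>"
        using k(1) by auto
    qed
    have grid: "grid_arrivals \<delta> a n j' (\<lambda>i. real (p (real i * \<delta>))) \<longleftrightarrow>
        j' = j \<and> (\<forall>i\<in>{1..n}. ereal (?S i) < a i)" for j'
      unfolding grid_arrivals_def S_iff S_iff'
      using uniq[of j'] j(1,2) early by blast
    have "p (real j * \<delta>) = n"
      using b1(2)[of "real j * \<delta>"] j \<delta>(2) pS by simp
    moreover have "p (real j * \<delta> + t) = p (?S n + t)"
      using b2(2)[of "real j * \<delta> + t"] j \<delta>(3) by simp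
    \<comment> \<open>The count has not moved during time \<open>t\<close> exactly if the next
      arrival is later still.\<close>
    moreover have "p (?S n + t) = n \<longleftrightarrow> ?S n + t < ?S (Suc n)"
      using arrival_le_iff[OF p, of "?S n + t" n] arrival_le_iff[OF p, of "?S n + t" "Suc n"]
        \<open>0 \<le> ?S n + t\<close> t by linarith
    ultimately show "(\<exists>j. grid_arrivals \<delta> a n j (\<lambda>i. real (p (real i * \<delta>)))) \<longleftrightarrow> (\<forall>i\<in>{1..n}. ereal (?S i) < a i)"
      "(\<exists>j. grid_arrivals \<delta> a n j (\<lambda>i. real (p (real i * \<delta>))) \<and> p (real j * \<delta> + t) = p (real j * \<delta>)) \<longleftrightarrow>
        (\<forall>i\<in>{1..n}. ereal (?S i) < a i) \<and> ?S n + t < ?S (Suc n)"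
      by (auto simp: grid)
  qed
  show "\<forall>\<^sub>F k in sequentially.
    (\<exists>j. grid_arrivals (1 / real (Suc k)) a n j (\<lambda>i. real (p (real i * (1 / real (Suc k)))))) \<longleftrightarrow>
      (\<forall>i\<in>{1..n}. ereal (arrival p i) < a i)"
    by (rule eventually_mono[OF main], elim conjE, rule key(1)) (assumption | simp)+
  show "\<forall>\<^sub>F k in sequentially.
    (\<exists>j. grid_arrivals (1 / real (Suc k)) a n j (\<lambda>i. real (p (real i * (1 / real (Suc k))))) \<and>
       p (real j * (1 / real (Suc k)) + t) = p (real j * (1 / real (Suc k)))) \<longleftrightarrow>
      (\<forall>i\<in>{1..n}. ereal (arrival p i) < a i) \<and> arrival p n + t < arrival p (Suc n)"
    by (rule eventually_mono[OF main], elim conjE, rule key(2)) (assumption | simp)+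
qed

lemma pred_grid_arrivals:
  assumes [measurable]: "\<And>k. (\<lambda>\<omega>. x k \<omega>) \<in> borel_measurable M"
  shows "Measurable.pred M (\<lambda>\<omega>. grid_arrivals \<delta> a n j (\<lambda>k. x k \<omega>))"
  unfolding grid_arrivals_def by measurable

lemma pred_nat_eq [measurable (raw)]:
  fixes f g :: "'a \<Rightarrow> nat"
  assumes [measurable]: "f \<in> M \<rightarrow>\<^sub>M count_space UNIV" "g \<in> M \<rightarrow>\<^sub>M count_space UNIV"
  shows "Measurable.pred M (\<lambda>\<omega>. f \<omega> = g \<omega>)"
proof -
  have "{\<omega>\<in>space M. real (f \<omega>) = real (g \<omega>)} \<in> sets M"
    by (intro borel_measurable_eq) measurable
  then show ?thesis by (simp add: pred_def)
qed

lemma grid_arrivals_cong: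
  assumes "\<And>k. k \<le> j \<Longrightarrow> x k = y k"
  shows "grid_arrivals \<delta> a n j x \<longleftrightarrow> grid_arrivals \<delta> a n j y"
  using assms by (simp add: grid_arrivals_def)

text \<open>The index is the first one at which level \<open>n\<close> is reached; the events for
  different \<open>j\<close> are therefore disjoint.\<close>

lemma grid_arrivals_unique:
  assumes "grid_arrivals \<delta> a n j x" "grid_arrivals \<delta> a n k x"
  shows "j = k"
  using assms unfolding grid_arrivals_def by (metis lessThan_iff linorder_neqE_nat not_less)

section \<open>Path properties of the Poisson process\<close>

lemma poisson_process_levy: "poisson_process M l N \<Longrightarrow> levy_process M (\<lambda>t \<omega>. real (N t \<omega>))"
  by (simp add: poisson_process_def)

lemma poisson_process_measurable:
  assumes "poisson_process M l N" "0 \<le> t"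
  shows "N t \<in> M \<rightarrow>\<^sub>M count_space UNIV"
proof -
  have [measurable]: "(\<lambda>\<omega>. real (N t \<omega>)) \<in> borel_measurable M"
    using levy_process_measurable[OF poisson_process_levy[OF assms(1)] assms(2)] .
  have "(\<lambda>\<omega>. nat \<lfloor>real (N t \<omega>)\<rfloor>) \<in> M \<rightarrow>\<^sub>M count_space UNIV"
    by measurable
  then show ?thesis by simp
qed

lemma poisson_process_marginal:
  assumes "poisson_process M l N" "0 < t"
  shows "measure M {\<omega>\<in>space M. N t \<omega> \<in> A} = measure_pmf.prob (poisson_pmf (l * t)) A"
proof -
  have [measurable]: "N t \<in> M \<rightarrow>\<^sub>M count_space UNIV"
    using assms by (intro poisson_process_measurable) auto
  have "distr M (count_space UNIV) (N t) = measure_pmf (poisson_pmf (l * t))"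
    using assms unfolding poisson_process_def by blast
  then have "measure_pmf.prob (poisson_pmf (l * t)) A = measure (distr M (count_space UNIV) (N t)) A"
    by simp
  also have "\<dots> = measure M {\<omega>\<in>space M. N t \<omega> \<in> A}"
    by (subst measure_distr) (auto intro!: arg_cong[where f="measure M"])
  finally show ?thesis by simp
qed

lemma poisson_process_increment:
  assumes P: "poisson_process M l N" and st: "0 \<le> s" "s < t"
  shows "measure M {\<omega>\<in>space M. real (N t \<omega>) - real (N s \<omega>) \<in> real ` A} =
    measure_pmf.prob (poisson_pmf (l * (t - s))) A"
proof -
  have "real ` A \<in> sets borel"
    by (intro borel_closed closed_subset_Ints) auto
  then have "measure M {\<omega>\<in>space M. real (N t \<omega>) - real (N s \<omega>) \<in> real ` A} =
    measure M {\<omega>\<in>space M. real (N (t - s) \<omega>) \<in> real ` A}"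
    using st by (intro levy_process_increment_measure[OF poisson_process_levy[OF P]]) auto
  also have "\<dots> = measure_pmf.prob (poisson_pmf (l * (t - s))) A"
    using poisson_process_marginal[OF P, of "t - s" A] st by (simp add: inj_image_mem_iff)
  finally show ?thesis .
qed

text \<open>The probability is \<open>1 - (1 + r) * exp (- r)\<close>, and
  \<open>exp (- r) \<ge> 1 - r\<close>. A bound quadratic in \<open>r\<close> outweighs the number
  of grid cells, which grows only linearly, in a union bound.\<close>

lemma poisson_tail_two:
  assumes "0 < r"
  shows "measure_pmf.prob (poisson_pmf r) {2..} \<le> r\<^sup>2"
proof -
  have "measure_pmf.prob (poisson_pmf r) {0, 1} = exp (- r) + r * exp (- r)"
    using assms by (subst measure_measure_pmf_finite) auto
  moreover have "{2..} = UNIV - {0, 1::nat}"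
    by auto
  ultimately have "measure_pmf.prob (poisson_pmf r) {2..} = 1 - (1 + r) * exp (- r)"
    using measure_pmf.prob_compl[of "{0, 1}" "poisson_pmf r"] by (simp add: algebra_simps)
  also have "\<dots> \<le> 1 - (1 + r) * (1 - r)"
    using assms exp_ge_add_one_self[of "- r"] by (intro diff_left_mono mult_left_mono) auto
  finally show ?thesis
    by (simp add: algebra_simps power2_eq_square)
qed

text \<open>By stationarity an increment has the law of a count, hence is nonnegative. The
  exceptional sets can be collected over countably many pairs of times only.\<close>

lemma poisson_process_mono_rats:
  assumes P: "poisson_process M l N"
  shows "AE \<omega> in M. \<forall>q\<in>{q\<in>\<rat>. 0 \<le> q}. \<forall>r\<in>{r\<in>\<rat>. 0 \<le> r}. q \<le> r \<longrightarrow> N q \<omega> \<le> N r \<omega>"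
proof -
  have "AE \<omega> in M. q \<le> r \<longrightarrow> N q \<omega> \<le> N r \<omega>" if "0 \<le> q" "0 \<le> r" for q r
  proof (cases "q \<le> r")
    case True
    have "AE \<omega> in M. real (N q \<omega>) \<le> real (N r \<omega>)"
      by (rule levy_process_increment_nonneg[OF poisson_process_levy[OF P]]) (use that True in auto)
    then show ?thesis by simp
  qed simp
  then show ?thesis
    by (intro AE_ball_countable' countable_nonneg_rats) auto
qed

text \<open>Staying below \<open>n\<close> forever is at most as likely as being below
  \<open>n\<close> at one late time, and there the Poisson weights are powers damped by an
  exponential.\<close>

lemma poisson_process_unbounded:
  assumes P: "poisson_process M l N" and l: "0 < l"
  shows "AE \<omega> in M. \<forall>n. \<exists>m::nat. n \<le> N (real m) \<omega>"
proof -
  interpret prob_space M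
    by (rule levy_process_prob_space[OF poisson_process_levy[OF P]])
  have [measurable]: "N t \<in> M \<rightarrow>\<^sub>M count_space UNIV" if "0 \<le> t" for t
    using P that by (rule poisson_process_measurable)
  have "AE \<omega> in M. \<exists>m::nat. n \<le> N (real m) \<omega>" for n
  proof -
    let ?B = "{\<omega>\<in>space M. \<forall>m::nat. N (real m) \<omega> < n}"
    have B[measurable]: "?B \<in> events" by measurable
    have le: "prob ?B \<le> (\<Sum>k<n. 1 / fact k * ((l * real (Suc m)) ^ k / exp (l * real (Suc m))))" for m
    proof -
      have "prob ?B \<le> prob {\<omega>\<in>space M. N (real (Suc m)) \<omega> \<in> {..<n}}"
        by (intro finite_measure_mono) (auto simp del: of_nat_Suc)
      also have "\<dots> = measure_pmf.prob (poisson_pmf (l * real (Suc m))) {..<n}"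
        by (rule poisson_process_marginal[OF P]) simp
      also have "\<dots> = (\<Sum>k<n. 1 / fact k * ((l * real (Suc m)) ^ k / exp (l * real (Suc m))))"
        using l by (subst measure_measure_pmf_finite) (auto simp: exp_minus divide_inverse mult_ac intro!: sum.cong)
      finally show ?thesis .
    qed
    have "filterlim (\<lambda>m. l * real (Suc m)) at_top sequentially"
      using l by (intro filterlim_tendsto_pos_mult_at_top[OF tendsto_const]
          filterlim_compose[OF filterlim_real_sequentially filterlim_Suc]) auto
    then have "(\<lambda>m. \<Sum>k<n. 1 / fact k * ((l * real (Suc m)) ^ k / exp (l * real (Suc m)))) \<longlonglongrightarrow> (\<Sum>k<n. 1 / fact k * 0)"
      by (intro tendsto_intros filterlim_compose[OF tendsto_power_div_exp_0])
    then have "prob ?B \<le> 0"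
      using le by (intro LIMSEQ_le_const) auto
    then have "prob ?B = 0"
      using measure_nonneg[of M ?B] by linarith
    then have "AE \<omega> in M. \<omega> \<notin> ?B"
      using prob_eq_0[OF B] by simp
    then show ?thesis
      by (auto elim!: eventually_mono simp: not_less)
  qed
  then show ?thesis
    by (simp add: AE_all_countable)
qed

lemma poisson_process_counting_path:
  assumes P: "poisson_process M l N" and l: "0 < l"
  shows "AE \<omega> in M. counting_path (\<lambda>t. N t \<omega>)"
proof -
  have "AE \<omega> in M. N 0 \<omega> = 0" "AE \<omega> in M. cadlag (\<lambda>t. real (N t \<omega>))"
    using poisson_process_levy[OF P] by (auto simp: levy_process_def)
  then show ?thesis
    using poisson_process_mono_rats[OF P] poisson_process_unbounded[OF P l]
  proof eventually_elim
    case (elim \<omega>)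
    let ?p = "\<lambda>t. N t \<omega>"
    have const: "\<exists>b>t. \<forall>u\<in>{t..<b}. ?p u = ?p t" if "0 \<le> t" for t
    proof -
      have "((\<lambda>u. real (?p u)) \<longlongrightarrow> real (?p t)) (at_right t)"
        using elim(2) that by (auto simp: cadlag_def continuous_within)
      \<comment> \<open>Natural numbers at distance less than 1 coincide.\<close>
      then have "\<forall>\<^sub>F u in at_right t. dist (real (?p u)) (real (?p t)) < 1"
        by (rule tendstoD) simp
      then obtain b where b: "b > t" "\<And>u. t < u \<Longrightarrow> u < b \<Longrightarrow> \<bar>real (?p u) - real (?p t)\<bar> < 1"
        by (auto simp: eventually_at_right_field dist_real_def)
      have "?p u = ?p t" if "u \<in> {t..<b}" for u
        using b(2)[of u] that by (cases "u = t") auto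
      then show ?thesis using b(1) by blast
    qed
    \<comment> \<open>Both times are replaced by slightly later rationals with the same counts, the
      earlier one still before \<open>v\<close>; monotonicity is already known at rationals.\<close>
    have "?p u \<le> ?p v" if uv: "0 \<le> u" "u < v" for u v
    proof -
      obtain b1 where b1: "b1 > u" "\<forall>w\<in>{u..<b1}. ?p w = ?p u" using const uv by blast
      obtain b2 where b2: "b2 > v" "\<forall>w\<in>{v..<b2}. ?p w = ?p v" using const[of v] uv by auto
      obtain q where q: "q \<in> \<rat>" "u < q" "q < min b1 v" using Rats_dense_in_real[of u "min b1 v"] b1 uv by auto
      obtain r where r: "r \<in> \<rat>" "v < r" "r < b2" using Rats_dense_in_real[of v b2] b2 by auto
      have "?p q = ?p u" "?p r = ?p v"
        using b1(2)[rule_format, of q] b2(2)[rule_format, of r] q r by simp_all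
      moreover have "?p q \<le> ?p r" using elim(3) q r uv by auto
      ultimately show ?thesis by simp
    qed
    then have "mono_on {0..} ?p"
      by (intro mono_onI) (auto simp: order_le_less)
    then show ?case
      unfolding counting_path_def using elim(1,4) const by auto
  qed
qed

text \<open>If two arrivals coincide before time \<open>K\<close>, then for every \<open>m\<close> some increment over a grid cell of length
  \<open>1 / Suc m\<close> is at least 2; by the union bound this has probability at most \<open>K * l\<^sup>2 / Suc m\<close>.\<close>

lemma poisson_process_simple:
  assumes P: "poisson_process M l N" and l: "0 < l"
  shows "AE \<omega> in M. \<forall>n. arrival (\<lambda>t. N t \<omega>) n < arrival (\<lambda>t. N t \<omega>) (Suc n)"
proof -
  interpret prob_space M
    by (rule levy_process_prob_space[OF poisson_process_levy[OF P]])
  have N_meas[measurable]: "N t \<in> M \<rightarrow>\<^sub>M count_space UNIV" if "0 \<le> t" for t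
    using P that by (rule poisson_process_measurable)
  \<comment> \<open>\<open>K * Suc m\<close> cells of length \<open>1 / Suc m\<close> cover
    \<open>{0..<K}\<close>; on \<open>B K m\<close> one of them sees an increment of at least
    2.\<close>
  define B where "B K m = (\<Union>j<K * Suc m. {\<omega>\<in>space M.
      real (N (real (Suc j) * (1 / real (Suc m))) \<omega>) - real (N (real j * (1 / real (Suc m))) \<omega>) \<in> real ` {2..}})"
    for K m :: nat
  have set[measurable]: "{\<omega>\<in>space M. real (N (real (Suc j) * (1 / real (Suc m))) \<omega>) -
      real (N (real j * (1 / real (Suc m))) \<omega>) \<in> real ` {2..}} \<in> events" for j m
  proof -
    have [measurable]: "real ` {2..} \<in> sets borel"
      by (intro borel_closed closed_subset_Ints) auto
    have [measurable]: "(\<lambda>\<omega>. real (N (real i * (1 / real (Suc m))) \<omega>)) \<in> borel_measurable M" for i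
      by (rule measurable_compose[OF N_meas]) auto
    show ?thesis by measurable
  qed
  have prob_B: "prob (B K m) \<le> real K * l\<^sup>2 * (1 / real (Suc m))" for K m
  proof -
    have "prob (B K m) \<le> (\<Sum>j<K * Suc m. prob {\<omega>\<in>space M. real (N (real (Suc j) * (1 / real (Suc m))) \<omega>) -
      real (N (real j * (1 / real (Suc m))) \<omega>) \<in> real ` {2..}})"
      unfolding B_def by (rule measure_UNION_le) (use set in auto)
    also have "\<dots> \<le> (\<Sum>j<K * Suc m. (l * (1 / real (Suc m)))\<^sup>2)"
    proof (rule sum_mono)
      fix j
      have d: "real (Suc j) * (1 / real (Suc m)) - real j * (1 / real (Suc m)) = 1 / real (Suc m)"
        by (simp add: field_simps)
      show "prob {\<omega>\<in>space M. real (N (real (Suc j) * (1 / real (Suc m))) \<omega>) -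
        real (N (real j * (1 / real (Suc m))) \<omega>) \<in> real ` {2..}} \<le> (l * (1 / real (Suc m)))\<^sup>2"
        by (subst poisson_process_increment[OF P])
           (use l in \<open>auto simp only: d intro!: poisson_tail_two\<close>, auto simp: divide_strict_right_mono)
    qed
    also have "\<dots> = real K * l\<^sup>2 * (1 / real (Suc m))"
    proof -
      have "real K * c * (l * (1 / c))\<^sup>2 = real K * l\<^sup>2 * (1 / c)" if "0 < c" for c
        using that by (simp add: power2_eq_square field_simps)
      then show ?thesis
        by (simp only: sum_constant card_lessThan of_nat_mult of_nat_0_less_iff zero_less_Suc)
    qed
    finally show ?thesis .
  qed
  have "AE \<omega> in M. \<exists>m. \<omega> \<notin> B K m" for K
  proof -
    let ?I = "\<Inter>m. B K m"
    have B_sets: "B K m \<in> events" for m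
      unfolding B_def using set by auto
    then have I: "?I \<in> events" by auto
    have "prob ?I \<le> real K * l\<^sup>2 * (1 / real (Suc m))" for m
      using prob_B[of K m] finite_measure_mono[of ?I "B K m"] B_sets by (meson INF_lower UNIV_I order_trans)
    moreover have "(\<lambda>m. real K * l\<^sup>2 * (1 / real (Suc m))) \<longlonglongrightarrow> real K * l\<^sup>2 * 0"
      by (intro tendsto_mult tendsto_const lim_1_over_n[THEN LIMSEQ_Suc])
    ultimately have "prob ?I \<le> 0"
      by (intro LIMSEQ_le_const) auto
    then have "prob ?I = 0"
      using measure_nonneg[of M ?I] by linarith
    then have "AE \<omega> in M. \<omega> \<notin> ?I"
      using prob_eq_0[OF I] by simp
    then show ?thesis by simp
  qed
  then have "AE \<omega> in M. \<forall>K. \<exists>m. \<omega> \<notin> B K m"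
    by (simp add: AE_all_countable)
  then show ?thesis
    using poisson_process_counting_path[OF P l] AE_space
  proof eventually_elim
    case (elim \<omega>)
    let ?p = "\<lambda>t. N t \<omega>"
    note p = elim(2)
    show ?case
    proof (rule allI, rule ccontr)
      fix n
      assume "\<not> arrival ?p n < arrival ?p (Suc n)"
      then have eq: "arrival ?p (Suc n) = arrival ?p n"
        using arrival_mono[OF p, of n "Suc n"] by simp
      \<comment> \<open>The coinciding arrivals are at a positive time, so the least grid point not
        before them has a predecessor \<open>j\<close>.\<close>
      have "\<not> Suc n \<le> ?p 0"
        using p by (simp add: counting_path_def)
      then have s_pos: "0 < arrival ?p n"
        using arrival_le_iff[OF p, of 0 "Suc n"] eq by simp
      obtain K where K: "arrival ?p n < real K"
        using reals_Archimedean2 by blast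
      have "\<omega> \<in> B K m" for m
      proof -
        let ?\<delta> = "1 / real (Suc m)"
        have "0 < ?\<delta>" by simp
        then obtain k where k: "arrival ?p n \<le> real k * ?\<delta>" "\<forall>i<k. real i * ?\<delta> < arrival ?p n"
          using least_grid_point[of ?\<delta> "arrival ?p n"] arrival_nonneg[of ?p n] by blast
        then obtain j where j: "k = Suc j"
          using s_pos by (cases k) auto
        have "real j * ?\<delta> < real K"
          using k(2) j K by (metis lessI order_less_trans)
        then have "real j < real (K * Suc m)"
          by (simp add: field_simps)
        then have "j < K * Suc m"
          by (simp only: of_nat_less_iff)
        \<comment> \<open>The count is below \<open>n\<close> at the left end of the cell and at
          least \<open>n + 1\<close> at its right end, a difference of at least 2.\<close>
        moreover have "\<not> n \<le> ?p (real j * ?\<delta>)"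
          using arrival_le_iff[OF p, of "real j * ?\<delta>" n] k(2) j by (metis \<open>0 < ?\<delta>\<close> lessI less_imp_le mult_nonneg_nonneg not_le of_nat_0_le_iff)
        moreover have "Suc n \<le> ?p (real (Suc j) * ?\<delta>)"
          using arrival_le_iff[OF p, of "real (Suc j) * ?\<delta>" "Suc n"] k(1) j eq by simp
        ultimately have "j < K * Suc m" "?p (real (Suc j) * ?\<delta>) \<ge> ?p (real j * ?\<delta>) + 2"
          by simp_all
        then have "real (?p (real (Suc j) * ?\<delta>)) - real (?p (real j * ?\<delta>)) \<in> real ` {2..}"
          by (intro image_eqI[of _ _ "?p (real (Suc j) * ?\<delta>) - ?p (real j * ?\<delta>)"]) (simp_all add: of_nat_diff)
        then show ?thesis
          unfolding B_def using \<open>j < K * Suc m\<close> elim(3) by blast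
      qed
      then show False using elim(1) by blast
    qed
  qed
qed

text \<open>For each \<open>j\<close> the grid event is a function of the increments up to
  \<open>j * \<delta>\<close>, and the next increment, over length \<open>t\<close>, vanishes
  independently with probability \<open>exp (- l * t)\<close>. The identities are summed over the
  disjoint events for different \<open>j\<close>.\<close>

lemma poisson_process_grid_markov:
  fixes a :: "nat \<Rightarrow> ereal" and n :: nat
  assumes P: "poisson_process M l N" and l: "0 < l" and t: "0 < t" and \<delta>: "0 < \<delta>"
  defines "G \<equiv> \<lambda>j \<omega>. grid_arrivals \<delta> a n j (\<lambda>k. real (N (real k * \<delta>) \<omega>))"
  shows "measure M {\<omega>\<in>space M. \<exists>j. G j \<omega> \<and> N (real j * \<delta> + t) \<omega> = N (real j * \<delta>) \<omega>} =
    exp (- l * t) * measure M {\<omega>\<in>space M. \<exists>j. G j \<omega>}"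
proof -
  note X = poisson_process_levy[OF P]
  interpret prob_space M
    by (rule levy_process_prob_space[OF X])
  have N_meas[measurable]: "N t \<in> M \<rightarrow>\<^sub>M count_space UNIV" if "0 \<le> t" for t
    using P that by (rule poisson_process_measurable)
  have [measurable]: "N (real k * \<delta>) \<in> M \<rightarrow>\<^sub>M count_space UNIV" "N (real k * \<delta> + t) \<in> M \<rightarrow>\<^sub>M count_space UNIV" for k
    using \<delta> t by (auto intro!: N_meas)
  have G_pred[measurable]: "Measurable.pred M (G j)" for j
    unfolding G_def by (rule pred_grid_arrivals) simp
  have step: "prob {\<omega>\<in>space M. G j \<omega> \<and> N (real j * \<delta> + t) \<omega> = N (real j * \<delta>) \<omega>} =
      exp (- l * t) * prob {\<omega>\<in>space M. G j \<omega>}" for j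
  proof -
    \<comment> \<open>Grid points up to \<open>j\<close>, followed by the single extra time
      \<open>j * \<delta> + t\<close>, so that the last increment has length
      \<open>t\<close>.\<close>
    define \<tau> where "\<tau> i = (if i \<le> j then real i * \<delta> else real j * \<delta> + t)" for i
    have "real r * \<delta> < real j * \<delta> + t" if "r \<le> j" for r
    proof -
      have "real r * \<delta> \<le> real j * \<delta>"
        using that \<delta> by (intro mult_right_mono) auto
      with t show ?thesis by linarith
    qed
    then have \<tau>: "0 \<le> \<tau> 0" "strict_mono_on {..Suc j} \<tau>"
      using \<delta> t by (auto simp: \<tau>_def strict_mono_on_def)
    let ?\<Delta> = "\<lambda>i \<omega>. real (N (\<tau> (Suc i)) \<omega>) - real (N (\<tau> i) \<omega>)"
    \<comment> \<open>Partial sums of increments give back the counts at grid points, but only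
      almost surely, since \<open>N 0 = 0\<close> is only almost sure. The intersection with
      \<open>{..<j}\<close> keeps the sum within the coordinates of the product space.\<close>
    define Q where "Q d = grid_arrivals \<delta> a n j (\<lambda>k. \<Sum>i\<in>{..<j} \<inter> {..<k}. d i)" for d :: "nat \<Rightarrow> real"
    have Q: "Measurable.pred (PiM {..<j} (\<lambda>_. borel)) Q"
      unfolding Q_def by (rule pred_grid_arrivals) (auto intro!: borel_measurable_sum)
    have "AE \<omega> in M. N 0 \<omega> = 0"
      using X by (simp add: levy_process_def)
    then have Q_iff: "AE \<omega> in M. Q (\<lambda>i\<in>{..<j}. ?\<Delta> i \<omega>) \<longleftrightarrow> G j \<omega>"
    proof eventually_elim
      case (elim \<omega>)
      have "(\<Sum>i\<in>{..<j} \<inter> {..<k}. (\<lambda>i\<in>{..<j}. ?\<Delta> i \<omega>) i) = real (N (real k * \<delta>) \<omega>)" if "k \<le> j" for k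
      proof -
        have "(\<Sum>i\<in>{..<j} \<inter> {..<k}. (\<lambda>i\<in>{..<j}. ?\<Delta> i \<omega>) i) = (\<Sum>i<k. ?\<Delta> i \<omega>)"
          using that by (intro sum.cong) auto
        also have "\<dots> = real (N (\<tau> k) \<omega>) - real (N (\<tau> 0) \<omega>)"
          by (rule sum_lessThan_telescope)
        finally show ?thesis using that elim by (simp add: \<tau>_def)
      qed
      then show ?case
        unfolding Q_def G_def by (intro grid_arrivals_cong)
    qed
    have \<tau>j: "\<tau> j = real j * \<delta>" "\<tau> (Suc j) = real j * \<delta> + t"
      by (auto simp: \<tau>_def)
    have \<tau>_nonneg: "0 \<le> \<tau> i" for i
      using \<delta> t by (simp add: \<tau>_def)
    have [measurable]: "N (\<tau> i) \<in> M \<rightarrow>\<^sub>M count_space UNIV" for i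
      using \<tau>_nonneg by (rule N_meas)
    have [measurable]: "Measurable.pred M (\<lambda>\<omega>. Q (\<lambda>i\<in>{..<j}. ?\<Delta> i \<omega>))"
      by (rule measurable_compose[OF _ Q]) measurable
    then have e1: "{\<omega>\<in>space M. Q (\<lambda>i\<in>{..<j}. ?\<Delta> i \<omega>)} \<in> events"
      by (rule predE)
    have e2: "{\<omega>\<in>space M. ?\<Delta> j \<omega> \<in> {0}} \<in> events"
      by measurable
    have "prob {\<omega>\<in>space M. G j \<omega> \<and> N (real j * \<delta> + t) \<omega> = N (real j * \<delta>) \<omega>} =
      prob {\<omega>\<in>space M. Q (\<lambda>i\<in>{..<j}. ?\<Delta> i \<omega>) \<and> ?\<Delta> j \<omega> \<in> {0}}"
    proof (rule finite_measure_eq_AE)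
      show "AE \<omega> in M. \<omega> \<in> {\<omega>\<in>space M. G j \<omega> \<and> N (real j * \<delta> + t) \<omega> = N (real j * \<delta>) \<omega>} \<longleftrightarrow>
          \<omega> \<in> {\<omega>\<in>space M. Q (\<lambda>i\<in>{..<j}. ?\<Delta> i \<omega>) \<and> ?\<Delta> j \<omega> \<in> {0}}"
        using Q_iff by eventually_elim (simp add: \<tau>j)
      have "{\<omega>\<in>space M. N (real j * \<delta> + t) \<omega> = N (real j * \<delta>) \<omega>} \<in> events"
        by measurable
      then show "{\<omega>\<in>space M. G j \<omega> \<and> N (real j * \<delta> + t) \<omega> = N (real j * \<delta>) \<omega>} \<in> events"
        using predE[OF G_pred] by (intro sets.sets_Collect_conj)
      show "{\<omega>\<in>space M. Q (\<lambda>i\<in>{..<j}. ?\<Delta> i \<omega>) \<and> ?\<Delta> j \<omega> \<in> {0}} \<in> events"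
        by (rule sets.sets_Collect_conj[OF e2 e1])
    qed
    also have "\<dots> = prob {\<omega>\<in>space M. Q (\<lambda>i\<in>{..<j}. ?\<Delta> i \<omega>)} * prob {\<omega>\<in>space M. ?\<Delta> j \<omega> \<in> {0}}"
      by (rule levy_process_indep_past[OF X \<tau> Q]) simp
    also have "prob {\<omega>\<in>space M. ?\<Delta> j \<omega> \<in> {0}} = measure_pmf.prob (poisson_pmf (l * t)) {0}"
      unfolding \<tau>j using poisson_process_increment[OF P, of "real j * \<delta>" "real j * \<delta> + t" "{0}"] t \<delta> by simp
    also have "\<dots> = exp (- l * t)"
      using l t by (simp add: measure_pmf_single)
    also have "prob {\<omega>\<in>space M. Q (\<lambda>i\<in>{..<j}. ?\<Delta> i \<omega>)} = prob {\<omega>\<in>space M. G j \<omega>}"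
    proof (rule finite_measure_eq_AE)
      show "AE \<omega> in M. \<omega> \<in> {\<omega>\<in>space M. Q (\<lambda>i\<in>{..<j}. ?\<Delta> i \<omega>)} \<longleftrightarrow> \<omega> \<in> {\<omega>\<in>space M. G j \<omega>}"
        using Q_iff by eventually_elim simp
      show "{\<omega>\<in>space M. G j \<omega>} \<in> events"
        by measurable
    qed (rule e1)
    finally show ?thesis by simp
  qed
  have uniq: "j = k" if "G j \<omega>" "G k \<omega>" for j k \<omega>
    using that unfolding G_def by (rule grid_arrivals_unique)
  have sums: "(\<lambda>j. prob {\<omega>\<in>space M. G j \<omega> \<and> R j \<omega>}) sums prob {\<omega>\<in>space M. \<exists>j. G j \<omega> \<and> R j \<omega>}"
    if [measurable]: "\<And>j. Measurable.pred M (R j)" for R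
  proof -
    have "{\<omega>\<in>space M. \<exists>j. G j \<omega> \<and> R j \<omega>} = (\<Union>j. {\<omega>\<in>space M. G j \<omega> \<and> R j \<omega>})"
      by auto
    then show ?thesis
      using uniq by (auto simp: disjoint_family_on_def intro!: finite_measure_UNION)
  qed
  have "(\<lambda>j. exp (- l * t) * prob {\<omega>\<in>space M. G j \<omega>}) sums (exp (- l * t) * prob {\<omega>\<in>space M. \<exists>j. G j \<omega>})"
    using sums[of "\<lambda>_ _. True"] by (intro sums_mult) simp
  moreover have "(\<lambda>j. exp (- l * t) * prob {\<omega>\<in>space M. G j \<omega>}) sums
      prob {\<omega>\<in>space M. \<exists>j. G j \<omega> \<and> N (real j * \<delta> + t) \<omega> = N (real j * \<delta>) \<omega>}"
    using sums[of "\<lambda>j \<omega>. N (real j * \<delta> + t) \<omega> = N (real j * \<delta>) \<omega>"] step by simp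
  ultimately show ?thesis
    by (rule sums_unique2[symmetric])
qed

lemma poisson_process_arrival_measurable:
  assumes P: "poisson_process M l N"
  shows "(\<lambda>\<omega>. arrival (\<lambda>t. N t \<omega>) n) \<in> borel_measurable M"
  unfolding arrival_def
proof (rule measurable_ratsup)
  fix q :: real assume "0 \<le> q"
  then have [measurable]: "N q \<in> M \<rightarrow>\<^sub>M count_space UNIV"
    by (rule poisson_process_measurable[OF P])
  show "Measurable.pred M (\<lambda>\<omega>. N q \<omega> < n)"
    by measurable
qed

text \<open>The mesh tends to 0: almost surely the grid events eventually agree with the exact ones,
  so their probabilities converge, and the factor \<open>exp (- l * t)\<close> does not depend on
  the mesh.\<close>

lemma poisson_process_markov:
  fixes a :: "nat \<Rightarrow> ereal" and n :: nat
  assumes P: "poisson_process M l N" and l: "0 < l" and t: "0 < t"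
  defines "S \<equiv> \<lambda>n \<omega>. arrival (\<lambda>t. N t \<omega>) n"
  shows "measure M {\<omega>\<in>space M. (\<forall>i\<in>{1..n}. ereal (S i \<omega>) < a i) \<and> S n \<omega> + t < S (Suc n) \<omega>} =
    exp (- l * t) * measure M {\<omega>\<in>space M. \<forall>i\<in>{1..n}. ereal (S i \<omega>) < a i}"
proof -
  interpret prob_space M
    by (rule levy_process_prob_space[OF poisson_process_levy[OF P]])
  have N_meas[measurable]: "N t \<in> M \<rightarrow>\<^sub>M count_space UNIV" if "0 \<le> t" for t
    using P that by (rule poisson_process_measurable)
  have S_meas[measurable]: "S i \<in> borel_measurable M" for i
    unfolding S_def by (rule poisson_process_arrival_measurable[OF P])
  define \<delta> where "\<delta> k = 1 / real (Suc k)" for k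
  have \<delta>: "0 < \<delta> k" for k by (simp add: \<delta>_def)
  have [measurable]: "N (real i * \<delta> k) \<in> M \<rightarrow>\<^sub>M count_space UNIV" "N (real i * \<delta> k + t) \<in> M \<rightarrow>\<^sub>M count_space UNIV" for i k
    using \<delta>[of k] t by (auto intro!: N_meas)
  define G where "G k j \<omega> = grid_arrivals (\<delta> k) a n j (\<lambda>i. real (N (real i * \<delta> k) \<omega>))" for k j \<omega>
  have G_pred[measurable]: "Measurable.pred M (G k j)" for k j
    unfolding G_def by (rule pred_grid_arrivals) simp
  have conv: "(\<lambda>k. prob {\<omega>\<in>space M. R k \<omega>}) \<longlonglongrightarrow> prob {\<omega>\<in>space M. R' \<omega>}"
    if [measurable]: "\<And>k. Measurable.pred M (R k)" "Measurable.pred M R'"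
      and ev: "AE \<omega> in M. \<forall>\<^sub>F k in sequentially. R k \<omega> \<longleftrightarrow> R' \<omega>" for R R'
  proof -
    have "(\<lambda>k. LINT \<omega>|M. indicator {\<omega>\<in>space M. R k \<omega>} \<omega> :: real) \<longlonglongrightarrow> (LINT \<omega>|M. indicator {\<omega>\<in>space M. R' \<omega>} \<omega>)"
    proof (rule integral_dominated_convergence[where w="\<lambda>_. 1"])
      show "AE \<omega> in M. (\<lambda>k. indicator {\<omega>\<in>space M. R k \<omega>} \<omega> :: real) \<longlonglongrightarrow> indicator {\<omega>\<in>space M. R' \<omega>} \<omega>"
        using ev
      proof eventually_elim
        case (elim \<omega>)
        then show ?case
          by (intro tendsto_eventually) (auto elim!: eventually_mono simp: indicator_def)
      qed
    qed (auto simp: indicator_def)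
    moreover have "(LINT \<omega>|M. indicator {\<omega>\<in>space M. R k \<omega>} \<omega> :: real) = prob {\<omega>\<in>space M. R k \<omega>}" for k
      by simp
    moreover have "(LINT \<omega>|M. indicator {\<omega>\<in>space M. R' \<omega>} \<omega> :: real) = prob {\<omega>\<in>space M. R' \<omega>}"
      by simp
    ultimately show ?thesis by simp
  qed
  have good: "AE \<omega> in M. counting_path (\<lambda>t. N t \<omega>)" "AE \<omega> in M. \<forall>n. arrival (\<lambda>t. N t \<omega>) n < arrival (\<lambda>t. N t \<omega>) (Suc n)"
    by (rule poisson_process_counting_path[OF P l], rule poisson_process_simple[OF P l])
  have "(\<lambda>k. prob {\<omega>\<in>space M. \<exists>j. G k j \<omega>}) \<longlonglongrightarrow> prob {\<omega>\<in>space M. \<forall>i\<in>{1..n}. ereal (S i \<omega>) < a i}"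
  proof (rule conv)
    show "AE \<omega> in M. \<forall>\<^sub>F k in sequentially. (\<exists>j. G k j \<omega>) \<longleftrightarrow> (\<forall>i\<in>{1..n}. ereal (S i \<omega>) < a i)"
      using good
    proof eventually_elim
      case (elim \<omega>)
      show ?case
        using grid_arrivals_limit(1)[OF elim(1) elim(2)[rule_format] less_imp_le[OF t], of a n]
        unfolding G_def \<delta>_def S_def .
    qed
  qed measurable
  then have lim1: "(\<lambda>k. exp (- l * t) * prob {\<omega>\<in>space M. \<exists>j. G k j \<omega>}) \<longlonglongrightarrow>
      exp (- l * t) * prob {\<omega>\<in>space M. \<forall>i\<in>{1..n}. ereal (S i \<omega>) < a i}"
    by (intro tendsto_intros)
  have lim2: "(\<lambda>k. prob {\<omega>\<in>space M. \<exists>j. G k j \<omega> \<and> N (real j * \<delta> k + t) \<omega> = N (real j * \<delta> k) \<omega>}) \<longlonglongrightarrow>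
      prob {\<omega>\<in>space M. (\<forall>i\<in>{1..n}. ereal (S i \<omega>) < a i) \<and> S n \<omega> + t < S (Suc n) \<omega>}"
  proof (rule conv)
    show "AE \<omega> in M. \<forall>\<^sub>F k in sequentially.
        (\<exists>j. G k j \<omega> \<and> N (real j * \<delta> k + t) \<omega> = N (real j * \<delta> k) \<omega>) \<longleftrightarrow>
        (\<forall>i\<in>{1..n}. ereal (S i \<omega>) < a i) \<and> S n \<omega> + t < S (Suc n) \<omega>"
      using good
    proof eventually_elim
      case (elim \<omega>)
      show ?case
        using grid_arrivals_limit(2)[OF elim(1) elim(2)[rule_format] less_imp_le[OF t], of a n]
        unfolding G_def \<delta>_def S_def .
    qed
  qed measurable
  have step: "prob {\<omega>\<in>space M. \<exists>j. G k j \<omega> \<and> N (real j * \<delta> k + t) \<omega> = N (real j * \<delta> k) \<omega>} =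
      exp (- l * t) * prob {\<omega>\<in>space M. \<exists>j. G k j \<omega>}" for k
    unfolding G_def by (rule poisson_process_grid_markov[OF P l t \<delta>])
  show ?thesis
    by (rule LIMSEQ_unique[OF lim2[unfolded step] lim1])
qed

text \<open>The past is generated by the intersection-stable family of events bounding
  \<open>S 1\<close>, ..., \<open>S n\<close>, the next gap by its tails. The Markov property gives
  independence on these generators, hence on the generated sigma-algebras, and the gaps split off
  one at a time.\<close>

lemma poisson_process_renewal:
  assumes P: "poisson_process M l N" and l: "0 < l"
  shows "\<exists>G. renewal_process M N G \<and> (\<forall>n\<ge>1. distributed M lborel (G n) (exponential_density l))"
proof -
  interpret prob_space M
    by (rule levy_process_prob_space[OF poisson_process_levy[OF P]])
  define S where "S n \<omega> = arrival (\<lambda>t. N t \<omega>) n" for n \<omega>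
  define G where "G n \<omega> = S n \<omega> - S (n - 1) \<omega>" for n \<omega>
  have S_meas[measurable]: "S i \<in> borel_measurable M" for i
    unfolding S_def by (rule poisson_process_arrival_measurable[OF P])
  have [measurable]: "G i \<in> borel_measurable M" for i
    unfolding G_def by measurable
  have path: "AE \<omega> in M. counting_path (\<lambda>t. N t \<omega>)"
    by (rule poisson_process_counting_path[OF P l])
  have G_pos: "AE \<omega> in M. 0 < G (Suc n) \<omega>" for n
    using poisson_process_simple[OF P l] by eventually_elim (simp add: G_def S_def)
  define \<A> where "\<A> n = {{\<omega>\<in>space M. \<forall>i\<in>{1..n}. ereal (S i \<omega>) < a i} | a :: nat \<Rightarrow> ereal. True}" for n
  define \<B> where "\<B> n = {{\<omega>\<in>space M. t < G (Suc n) \<omega>} | t :: real. True}" for n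
  \<comment> \<open>\<open>max 0 t\<close> extends the formula to \<open>t \<le> 0\<close>, where
    the gap exceeds \<open>t\<close> almost surely. Tails at all real \<open>t\<close> serve as
    generators.\<close>
  have markov: "prob (A \<inter> {\<omega>\<in>space M. t < G (Suc n) \<omega>}) = exp (- l * max 0 t) * prob A"
    if A_mem: "A \<in> \<A> n" for A n t
  proof -
    obtain a :: "nat \<Rightarrow> ereal" where A: "A = {\<omega>\<in>space M. \<forall>i\<in>{1..n}. ereal (S i \<omega>) < a i}"
      using A_mem unfolding \<A>_def by blast
    show ?thesis
    proof (cases "0 < t")
      case True
      have "A \<inter> {\<omega>\<in>space M. t < G (Suc n) \<omega>} =
          {\<omega>\<in>space M. (\<forall>i\<in>{1..n}. ereal (S i \<omega>) < a i) \<and> S n \<omega> + t < S (Suc n) \<omega>}"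
        by (auto simp: A G_def)
      then show ?thesis
        using poisson_process_markov[OF P l True, of n a] True by (simp add: A S_def)
    next
      case False
      have "prob (A \<inter> {\<omega>\<in>space M. t < G (Suc n) \<omega>}) = prob A"
      proof (rule finite_measure_eq_AE)
        show "AE \<omega> in M. \<omega> \<in> A \<inter> {\<omega>\<in>space M. t < G (Suc n) \<omega>} \<longleftrightarrow> \<omega> \<in> A"
          using G_pos[of n] False by (auto elim!: eventually_mono simp: A)
      qed (unfold A, measurable)
      then show ?thesis using False by (simp add: max_def)
    qed
  qed
  \<comment> \<open>With all bounds infinite the past is unconstrained, and \<open>markov\<close>
    becomes the tail of a single gap.\<close>
  have space_A: "space M \<in> \<A> n" for n
    unfolding \<A>_def by (auto intro!: exI[of _ "\<lambda>_. \<infinity>"])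
  have tail: "prob {\<omega>\<in>space M. t < G (Suc n) \<omega>} = exp (- l * max 0 t)" for n t
  proof -
    have "space M \<inter> {\<omega>\<in>space M. t < G (Suc n) \<omega>} = {\<omega>\<in>space M. t < G (Suc n) \<omega>}"
      by auto
    then show ?thesis
      using markov[OF space_A, of t n] prob_space by simp
  qed
  have expo: "distributed M lborel (G n) (exponential_density l)" if n: "1 \<le> n" for n
    unfolding exponential_distributed_iff[OF l]
  proof (intro conjI allI impI)
    fix a :: real assume a: "0 \<le> a"
    obtain m where m: "n = Suc m" using n by (cases n) auto
    have "{\<omega>\<in>space M. G n \<omega> \<le> a} = space M - {\<omega>\<in>space M. a < G (Suc m) \<omega>}"
      using m by (auto simp: not_less)
    then have "prob {\<omega>\<in>space M. G n \<omega> \<le> a} = 1 - prob {\<omega>\<in>space M. a < G (Suc m) \<omega>}"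
      by (simp add: prob_compl)
    then show "prob {\<omega>\<in>space M. G n \<omega> \<le> a} = 1 - exp (- a * l)"
      using tail[of a m] a by (simp add: mult.commute)
  qed simp
  have ind: "indep_set (sigma_sets (space M) (\<A> n)) (sigma_sets (space M) (\<B> n))" for n
  proof (rule indep_set_sigma_sets)
    show "indep_set (\<A> n) (\<B> n)"
    proof (rule indep_setI)
      show "\<A> n \<subseteq> events" unfolding \<A>_def by auto
      show "\<B> n \<subseteq> events" unfolding \<B>_def by auto
      show "prob (A \<inter> B) = prob A * prob B" if "A \<in> \<A> n" "B \<in> \<B> n" for A B
        using that(2) markov[OF that(1)] tail by (auto simp: \<B>_def)
    qed
    show "Int_stable (\<A> n)"
    proof (rule Int_stableI)
      fix A B assume "A \<in> \<A> n" "B \<in> \<A> n"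
      then obtain a b :: "nat \<Rightarrow> ereal" where "A = {\<omega>\<in>space M. \<forall>i\<in>{1..n}. ereal (S i \<omega>) < a i}"
          "B = {\<omega>\<in>space M. \<forall>i\<in>{1..n}. ereal (S i \<omega>) < b i}"
        unfolding \<A>_def by blast
      then have "A \<inter> B = {\<omega>\<in>space M. \<forall>i\<in>{1..n}. ereal (S i \<omega>) < min (a i) (b i)}"
        by auto
      then show "A \<inter> B \<in> \<A> n"
        unfolding \<A>_def by (auto intro!: exI[of _ "\<lambda>i. min (a i) (b i)"])
    qed
    show "Int_stable (\<B> n)"
    proof (rule Int_stableI)
      fix A B assume "A \<in> \<B> n" "B \<in> \<B> n"
      then obtain s t where "A = {\<omega>\<in>space M. s < G (Suc n) \<omega>}" "B = {\<omega>\<in>space M. t < G (Suc n) \<omega>}"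
        by (auto simp: \<B>_def)
      then have "A \<inter> B = {\<omega>\<in>space M. max s t < G (Suc n) \<omega>}"
        by auto
      then show "A \<inter> B \<in> \<B> n"
        unfolding \<B>_def by blast
    qed
  qed
  have past: "{\<omega>\<in>space M. \<forall>i\<in>{1..n}. G i \<omega> \<in> A i} \<in> sigma_sets (space M) (\<A> n)"
    if A[measurable]: "\<And>i. A i \<in> sets borel" for A :: "nat \<Rightarrow> real set" and n
  proof -
    let ?\<Sigma> = "sigma (space M) (\<A> n)"
    have sub: "\<A> n \<subseteq> Pow (space M)"
      by (auto simp: \<A>_def)
    have sp: "space ?\<Sigma> = space M" and st: "sets ?\<Sigma> = sigma_sets (space M) (\<A> n)"
      using sub by (auto simp: space_measure_of sets_measure_of)
    have S: "S i \<in> borel_measurable ?\<Sigma>" if i: "i \<in> {0..n}" for i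
    proof (cases "i = 0")
      case True
      then have "S i = (\<lambda>_. 0)" by (auto simp: S_def)
      then show ?thesis by simp
    next
      case False
      show ?thesis
      proof (rule borel_measurableI_less)
        fix c
        have "{\<omega>\<in>space M. S i \<omega> < c} = {\<omega>\<in>space M. \<forall>j\<in>{1..n}. ereal (S j \<omega>) < (if j = i then ereal c else \<infinity>)}"
          using i False by auto
        also have "\<dots> \<in> \<A> n"
          unfolding \<A>_def mem_Collect_eq by (rule exI[of _ "\<lambda>j. if j = i then ereal c else \<infinity>"]) simp
        finally show "{\<omega>\<in>space ?\<Sigma>. S i \<omega> < c} \<in> sets ?\<Sigma>"
          unfolding sp st by (rule sigma_sets.Basic)
      qed
    qed
    have [measurable]: "i \<in> {1..n} \<Longrightarrow> G i \<in> borel_measurable ?\<Sigma>" for i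
      unfolding G_def by (intro borel_measurable_diff S) auto
    have "{\<omega>\<in>space ?\<Sigma>. \<forall>i\<in>{1..n}. G i \<omega> \<in> A i} \<in> sets ?\<Sigma>"
      by measurable
    then show ?thesis unfolding sp st .
  qed
  have next_gap: "{\<omega>\<in>space M. G (Suc n) \<omega> \<in> A} \<in> sigma_sets (space M) (\<B> n)"
    if [measurable]: "A \<in> sets borel" for A n
  proof -
    let ?\<Sigma> = "sigma (space M) (\<B> n)"
    have sub: "\<B> n \<subseteq> Pow (space M)"
      by (auto simp: \<B>_def)
    have sp: "space ?\<Sigma> = space M" and st: "sets ?\<Sigma> = sigma_sets (space M) (\<B> n)"
      using sub by (auto simp: space_measure_of sets_measure_of)
    have [measurable]: "G (Suc n) \<in> borel_measurable ?\<Sigma>"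
    proof (rule borel_measurableI_greater)
      show "{\<omega>\<in>space ?\<Sigma>. c < G (Suc n) \<omega>} \<in> sets ?\<Sigma>" for c
        unfolding sp st by (rule sigma_sets.Basic) (auto simp: \<B>_def)
    qed
    have "{\<omega>\<in>space ?\<Sigma>. G (Suc n) \<omega> \<in> A} \<in> sets ?\<Sigma>"
      by measurable
    then show ?thesis unfolding sp st .
  qed
  have "indep_vars (\<lambda>_. borel) G {1..}"
  proof (rule indep_vars_atLeast_oneI)
    fix n and A :: "nat \<Rightarrow> real set" assume A: "\<And>i. A i \<in> sets borel"
    show "prob {\<omega>\<in>space M. \<forall>i\<in>{1..n}. G i \<omega> \<in> A i} = (\<Prod>i=1..n. prob {\<omega>\<in>space M. G i \<omega> \<in> A i})"
    proof (induction n)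
      case 0
      then show ?case using prob_space by simp
    next
      case (Suc n)
      have "{\<omega>\<in>space M. \<forall>i\<in>{1..Suc n}. G i \<omega> \<in> A i} =
          {\<omega>\<in>space M. \<forall>i\<in>{1..n}. G i \<omega> \<in> A i} \<inter> {\<omega>\<in>space M. G (Suc n) \<omega> \<in> A (Suc n)}"
        by (auto simp: atLeastAtMostSuc_conv)
      then show ?case
        using indep_setD[OF ind past[of A n, OF A] next_gap[of "A (Suc n)" n, OF A]] Suc by simp
    qed
  qed simp
  moreover have "distr M borel (G n) = distr M borel (G 1)" if "1 \<le> n" for n
    using distributed_distr_eq_density[OF expo[OF that]] distributed_distr_eq_density[OF expo[of 1]]
    by (simp cong: distr_cong)
  moreover have "AE \<omega> in M. 0 < G n \<omega>" if "1 \<le> n" for n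
    using G_pos[of "n - 1"] that by simp
  moreover have "AE \<omega> in M. \<forall>t\<ge>0. finite {n. 1 \<le> n \<and> (\<Sum>k=1..n. G k \<omega>) \<le> t} \<and>
      N t \<omega> = card {n. 1 \<le> n \<and> (\<Sum>k=1..n. G k \<omega>) \<le> t}"
    using path
  proof eventually_elim
    case (elim \<omega>)
    have "(\<Sum>k=1..n. G k \<omega>) = S n \<omega>" for n
      by (induction n) (auto simp: G_def S_def)
    then show ?case
      using counting_path_eq_card[OF elim] by (simp add: S_def)
  qed
  ultimately show ?thesis
    using expo prob_space_axioms unfolding renewal_process_def by blast
qed

section \<open>Time change by an inverse subordinator\<close>

text \<open>The last clause keeps the set in \<open>inverse_subordinator\<close> nonempty; the
  \<open>Inf\<close> of an empty set of reals would carry no information.\<close>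

definition subordinator_path :: "(real \<Rightarrow> real) \<Rightarrow> bool" where
  "subordinator_path d \<longleftrightarrow> mono_on {0..} d \<and> d 0 = 0 \<and> (\<forall>x. \<exists>m::nat. x < d (real m))"

text \<open>\<open>r\<close> is a lower bound of the passage set exactly if no \<open>u < r\<close>
  has \<open>D u > t\<close>, that is, if the supremum of \<open>D\<close> before \<open>r\<close>
  is at most \<open>t\<close>. Later comparisons of \<open>D\<close> with its inverse rest on this
  duality.\<close>

lemma le_inverse_subordinator_iff:
  assumes d: "subordinator_path (\<lambda>t. D t \<omega>)" and t: "0 \<le> t"
  shows "r \<le> inverse_subordinator D t \<omega> \<longleftrightarrow> left_lim (\<lambda>t. D t \<omega>) r \<le> t"
proof -
  let ?A = "{r. 0 \<le> r \<and> t < D r \<omega>}"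
  obtain m :: nat where "t < D (real m) \<omega>"
    using d unfolding subordinator_path_def by blast
  then have ne: "?A \<noteq> {}"
    by (auto intro!: exI[of _ "real m"])
  have bdd: "bdd_below ?A"
    by (rule bdd_belowI[of _ 0]) auto
  have "left_lim (\<lambda>t. D t \<omega>) r \<le> t \<longleftrightarrow> (\<forall>u. 0 \<le> u \<longrightarrow> u < r \<longrightarrow> D u \<omega> \<le> t)"
    using d t by (intro left_lim_le_iff) (auto simp: subordinator_path_def)
  also have "\<dots> \<longleftrightarrow> (\<forall>u\<in>?A. r \<le> u)"
    by (auto simp: not_less[symmetric] simp del: not_less)
  also have "\<dots> \<longleftrightarrow> r \<le> Inf ?A"
    by (rule le_cInf_iff[OF ne bdd, symmetric])
  finally show ?thesis
    unfolding inverse_subordinator_def by simp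
qed

lemma inverse_subordinator_nonneg:
  assumes d: "subordinator_path (\<lambda>t. D t \<omega>)" and t: "0 \<le> t"
  shows "0 \<le> inverse_subordinator D t \<omega>"
  using le_inverse_subordinator_iff[where D=D and \<omega>=\<omega>, OF assms, of 0] t by simp

text \<open>Negating the duality, \<open>E q < r\<close> means that \<open>q\<close> is below the
  left limit. So left limits of \<open>D\<close> are functionals of the path of the inverse, to
  which the independence assumption applies.\<close>

lemma ratsup_inverse_subordinator:
  assumes d: "subordinator_path (\<lambda>t. D t \<omega>)"
  shows "ratsup (\<lambda>q. inverse_subordinator D q \<omega> < r) = left_lim (\<lambda>t. D t \<omega>) r"
proof -
  have "inverse_subordinator D q \<omega> < r \<longleftrightarrow> q < left_lim (\<lambda>t. D t \<omega>) r" if "0 \<le> q" for q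
    unfolding not_le[symmetric] using le_inverse_subordinator_iff[where D=D and \<omega>=\<omega>, OF d that] by blast
  then show ?thesis
    by (intro ratsup_eqI left_lim_nonneg) auto
qed

text \<open>The opposite direction: values of \<open>D\<close> at rational times yield a version of
  the inverse that is measurable on the original space.\<close>

lemma inverse_subordinator_eq_ratsup:
  assumes d: "subordinator_path (\<lambda>t. D t \<omega>)" and t: "0 \<le> t"
  shows "inverse_subordinator D t \<omega> = ratsup (\<lambda>q. D q \<omega> \<le> t)"
proof (rule ratsup_eqI[symmetric, OF inverse_subordinator_nonneg[where D=D and \<omega>=\<omega>, OF assms]])
  have iff: "r \<le> inverse_subordinator D t \<omega> \<longleftrightarrow> (\<forall>u. 0 \<le> u \<longrightarrow> u < r \<longrightarrow> D u \<omega> \<le> t)" for r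
    unfolding le_inverse_subordinator_iff[where D=D and \<omega>=\<omega>, OF assms]
    using d t by (intro left_lim_le_iff) (auto simp: subordinator_path_def)
  fix q :: real assume q: "0 \<le> q"
  show "D q \<omega> \<le> t" if "q < inverse_subordinator D t \<omega>"
    using iff[of "inverse_subordinator D t \<omega>"] q that by blast
  show "q \<le> inverse_subordinator D t \<omega>" if "D q \<omega> \<le> t"
    unfolding iff
  proof (intro allI impI)
    fix u assume u: "0 \<le> u" "u < q"
    have "D u \<omega> \<le> D q \<omega>"
      using d u q unfolding subordinator_path_def mono_on_def by simp
    with that show "D u \<omega> \<le> t" by simp
  qed
qed

text \<open>\<open>f_top\<close> is what is kept of an infinite Levy measure. In this form the
  locale serves \<open>s powr \<beta>\<close>, \<open>f s\<close> and
  \<open>f s powr \<beta>\<close> alike, and no Levy measure has to be exhibited for the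
  powers.\<close>

locale unbounded_subordinator =
  fixes M :: "'a measure" and f :: "real \<Rightarrow> real" and D :: "real \<Rightarrow> 'a \<Rightarrow> real"
  assumes sub: "subordinator M f D"
    and f_top: "filterlim (\<lambda>k. f (real k)) at_top sequentially"
begin

lemma levy: "levy_process M D"
  using sub by (simp add: subordinator_def)

sublocale prob_space M
  by (rule levy_process_prob_space[OF levy])

lemma D_measurable [measurable (raw)]: "0 \<le> t \<Longrightarrow> D t \<in> borel_measurable M"
  by (rule levy_process_measurable[OF levy])

lemma laplace: "0 < s \<Longrightarrow> 0 \<le> t \<Longrightarrow> (LINT \<omega>|M. exp (- s * D t \<omega>)) = exp (- t * f s)"
  using sub by (simp add: subordinator_def)

lemma D_0: "AE \<omega> in M. D 0 \<omega> = 0"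
  using levy by (simp add: levy_process_def)

lemma D_mono: "AE \<omega> in M. mono_on {0..} (\<lambda>t. D t \<omega>)"
  using sub by (simp add: subordinator_def)

lemma D_nonneg: "AE \<omega> in M. \<forall>t\<ge>0. 0 \<le> D t \<omega>"
  using D_0 D_mono
proof eventually_elim
  case (elim \<omega>)
  show ?case
  proof (intro allI impI)
    fix t :: real assume "0 \<le> t"
    then have "D 0 \<omega> \<le> D t \<omega>"
      using elim(2) by (auto simp: mono_on_def)
    then show "0 \<le> D t \<omega>" using elim(1) by simp
  qed
qed

lemma integrable_exp_D:
  assumes "0 < s" "0 \<le> t"
  shows "integrable M (\<lambda>\<omega>. exp (- s * D t \<omega>))"
proof (rule integrable_const_bound[where B=1])
  have [measurable]: "D t \<in> borel_measurable M"
    using assms by (intro D_measurable)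
  show "(\<lambda>\<omega>. exp (- s * D t \<omega>)) \<in> borel_measurable M"
    by measurable
  show "AE \<omega> in M. norm (exp (- s * D t \<omega>)) \<le> 1"
    using D_nonneg by eventually_elim (use assms in simp)
qed

lemma exponent_large: "\<exists>k::nat. 0 < k \<and> C < f (real k)"
proof -
  have "\<forall>\<^sub>F k in sequentially. C < f (real k)"
    using f_top unfolding filterlim_at_top_dense by blast
  then have "\<forall>\<^sub>F k in sequentially. 0 < k \<and> C < f (real k)"
    by (rule eventually_conj[OF eventually_gt_at_top])
  then show ?thesis
    using eventually_happens sequentially_bot by blast
qed

text \<open>Chernoff bound: where \<open>D t \<le> x\<close>, the integrand
  \<open>exp (s * x) * exp (- s * D t)\<close> is at least 1. With \<open>s\<close> fixed and
  \<open>t\<close> large it yields unbounded paths, with \<open>t\<close> fixed and \<open>s\<close>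
  large it yields \<open>D t > 0\<close>.\<close>

lemma prob_D_le:
  assumes "0 < s" "0 \<le> t"
  shows "prob {\<omega>\<in>space M. D t \<omega> \<le> x} \<le> exp (s * x) * exp (- t * f s)"
proof -
  have [measurable]: "D t \<in> borel_measurable M"
    using assms by (intro D_measurable)
  have "prob {\<omega>\<in>space M. D t \<omega> \<le> x} = (LINT \<omega>|M. indicator {\<omega>\<in>space M. D t \<omega> \<le> x} \<omega>)"
    by simp
  also have "\<dots> \<le> (LINT \<omega>|M. exp (s * x) * exp (- s * D t \<omega>))"
  proof (rule integral_mono)
    show "integrable M (\<lambda>\<omega>. exp (s * x) * exp (- s * D t \<omega>))"
      using integrable_exp_D[OF assms] by simp
    show "indicator {\<omega>\<in>space M. D t \<omega> \<le> x} \<omega> \<le> exp (s * x) * exp (- s * D t \<omega>)" for \<omega>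
      using assms by (auto simp: indicator_def exp_add[symmetric] mult_left_mono)
  qed (auto simp: less_top[symmetric])
  also have "\<dots> = exp (s * x) * exp (- t * f s)"
    using laplace[OF assms] by simp
  finally show ?thesis .
qed

lemma path: "AE \<omega> in M. subordinator_path (\<lambda>t. D t \<omega>)"
proof -
  obtain k :: nat where k: "0 < k" "0 < f (real k)"
    using exponent_large[of 0] by blast
  have "AE \<omega> in M. \<exists>m::nat. real n < D (real m) \<omega>" for n :: nat
  proof -
    let ?B = "{\<omega>\<in>space M. \<forall>m::nat. D (real m) \<omega> \<le> real n}"
    have B: "?B \<in> events" by measurable
    have le: "prob ?B \<le> exp (real k * real n) * exp (- real m * f (real k))" for m
    proof -
      have "prob ?B \<le> prob {\<omega>\<in>space M. D (real m) \<omega> \<le> real n}"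
        by (intro finite_measure_mono) auto
      also have "\<dots> \<le> exp (real k * real n) * exp (- real m * f (real k))"
        using k by (intro prob_D_le) auto
      finally show ?thesis .
    qed
    have "(\<lambda>m. exp (real k * real n) * exp (- real m * f (real k))) \<longlonglongrightarrow> exp (real k * real n) * 0"
    proof (intro tendsto_intros filterlim_compose[OF exp_at_bot])
      have "filterlim (\<lambda>m. f (real k) * real m) at_top sequentially"
        using k by (intro filterlim_tendsto_pos_mult_at_top[OF tendsto_const] filterlim_real_sequentially)
      then show "filterlim (\<lambda>m. - real m * f (real k)) at_bot sequentially"
        by (simp add: filterlim_uminus_at_bot mult.commute)
    qed
    then have "prob ?B \<le> exp (real k * real n) * 0"
      by (rule LIMSEQ_le_const) (use le in blast)
    then have "prob ?B = 0"
      using measure_nonneg[of M ?B] by linarith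
    then have "AE \<omega> in M. \<omega> \<notin> ?B"
      using prob_eq_0[OF B] by simp
    then show ?thesis
      using AE_space by eventually_elim (auto simp: not_le)
  qed
  then have "AE \<omega> in M. \<forall>n::nat. \<exists>m::nat. real n < D (real m) \<omega>"
    by (simp add: AE_all_countable)
  then show ?thesis
    using D_0 D_mono
  proof eventually_elim
    case (elim \<omega>)
    have "\<exists>m::nat. x < D (real m) \<omega>" for x
    proof -
      obtain n :: nat where "x < real n" using reals_Archimedean2 by blast
      moreover obtain m :: nat where "real n < D (real m) \<omega>" using elim(1) by blast
      ultimately have "x < D (real m) \<omega>" by simp
      then show ?thesis ..
    qed
    then show ?case
      using elim by (simp add: subordinator_path_def)
  qed
qed

lemma D_pos:
  assumes t: "0 < t"
  shows "AE \<omega> in M. 0 < D t \<omega>"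
proof -
  let ?B = "{\<omega>\<in>space M. D t \<omega> \<le> 0}"
  have [measurable]: "D t \<in> borel_measurable M"
    using t by (intro D_measurable) simp
  have B: "?B \<in> events" by measurable
  have "prob ?B \<le> exp (- C)" for C
  proof -
    obtain k :: nat where k: "0 < k" "C / t < f (real k)"
      using exponent_large by blast
    have "prob ?B \<le> exp (- t * f (real k))"
      using prob_D_le[of "real k" t 0] k t by simp
    also have "\<dots> \<le> exp (- C)"
      using k(2) t by (simp add: field_simps)
    finally show ?thesis .
  qed
  moreover have "(\<lambda>m. exp (- real m)) \<longlonglongrightarrow> 0"
    by (intro filterlim_compose[OF exp_at_bot]) (simp add: filterlim_uminus_at_bot filterlim_real_sequentially)
  ultimately have "prob ?B \<le> 0"
    by (intro LIMSEQ_le_const[of "\<lambda>m. exp (- real m)"]) auto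
  then have "prob ?B = 0"
    using measure_nonneg[of M ?B] by linarith
  then have "AE \<omega> in M. \<omega> \<notin> ?B"
    using prob_eq_0[OF B] by simp
  then show ?thesis
    using AE_space by eventually_elim auto
qed

lemma left_lim_measurable [measurable (raw)]:
  "R \<in> borel_measurable M \<Longrightarrow> (\<lambda>\<omega>. left_lim (\<lambda>t. D t \<omega>) (R \<omega>)) \<in> borel_measurable M"
  by (rule measurable_left_lim) auto

text \<open>There are no fixed discontinuities: \<open>exp (- s * left_lim D r)\<close> dominates \<open>exp (- s * D r)\<close> and
  has at most the same integral.\<close>

lemma left_lim_eq:
  assumes r: "0 \<le> r"
  shows "AE \<omega> in M. left_lim (\<lambda>t. D t \<omega>) r = D r \<omega>"
proof (cases "r = 0")
  case True
  then show ?thesis using D_0 by (auto elim!: eventually_mono)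
next
  case False
  with r have r: "0 < r" by simp
  obtain k :: nat where "0 < k" "0 < f (real k)"
    using exponent_large[of 0] by blast
  then obtain s where s: "0 < s" "0 < f s" by (metis of_nat_0_less_iff)
  let ?L = "\<lambda>\<omega>. left_lim (\<lambda>t. D t \<omega>) r"
  have [measurable]: "D r \<in> borel_measurable M" using r by (intro D_measurable) simp
  have between: "AE \<omega> in M. ?L \<omega> \<le> D r \<omega> \<and> (\<forall>u. 0 \<le> u \<longrightarrow> u < r \<longrightarrow> D u \<omega> \<le> ?L \<omega>)"
    using path D_nonneg
  proof eventually_elim
    case (elim \<omega>)
    then have d: "mono_on {0..} (\<lambda>t. D t \<omega>)" "D 0 \<omega> = 0"
      by (auto simp: subordinator_path_def)
    have "?L \<omega> \<le> D r \<omega>"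
      using left_lim_le_iff[OF d, of "D r \<omega>" r] elim(2) d(1) r by (auto simp: mono_on_def)
    moreover have "\<forall>u. 0 \<le> u \<longrightarrow> u < r \<longrightarrow> D u \<omega> \<le> ?L \<omega>"
      using left_lim_le_iff[OF d left_lim_nonneg, of r "\<lambda>t. D t \<omega>" r] by simp
    ultimately show ?case by simp
  qed
  have int_L: "integrable M (\<lambda>\<omega>. exp (- s * ?L \<omega>))"
    using s by (intro integrable_const_bound[where B=1]) (auto simp: left_lim_nonneg)
  have upper: "(LINT \<omega>|M. exp (- s * ?L \<omega>)) \<le> exp (- u * f s)" if u: "0 \<le> u" "u < r" for u
  proof -
    have "(LINT \<omega>|M. exp (- s * ?L \<omega>)) \<le> (LINT \<omega>|M. exp (- s * D u \<omega>))"
    proof (rule integral_mono_AE[OF int_L integrable_exp_D[OF s(1) u(1)]])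
      show "AE \<omega> in M. exp (- s * ?L \<omega>) \<le> exp (- s * D u \<omega>)"
        using between by eventually_elim (use u s in simp)
    qed
    then show ?thesis using laplace[OF s(1) u(1)] by simp
  qed
  have "((\<lambda>u. exp (- u * f s)) \<longlongrightarrow> exp (- r * f s)) (at_left r)"
    by (intro tendsto_intros)
  moreover have "\<forall>\<^sub>F u in at_left r. (LINT \<omega>|M. exp (- s * ?L \<omega>)) \<le> exp (- u * f s)"
    using eventually_at_left_real[OF r] by eventually_elim (rule upper, simp_all)
  ultimately have "(LINT \<omega>|M. exp (- s * ?L \<omega>)) \<le> exp (- r * f s)"
    by (rule tendsto_lowerbound) simp
  then have "(LINT \<omega>|M. exp (- s * ?L \<omega>) - exp (- s * D r \<omega>)) \<le> 0"
    using int_L integrable_exp_D[OF s(1), of r] laplace[OF s(1), of r] r by simp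
  moreover have nonneg: "AE \<omega> in M. 0 \<le> exp (- s * ?L \<omega>) - exp (- s * D r \<omega>)"
    using between by eventually_elim (use s in simp)
  then have "0 \<le> (LINT \<omega>|M. exp (- s * ?L \<omega>) - exp (- s * D r \<omega>))"
    by (rule integral_nonneg_AE)
  ultimately have "(LINT \<omega>|M. exp (- s * ?L \<omega>) - exp (- s * D r \<omega>)) = 0"
    by simp
  then have "AE \<omega> in M. exp (- s * ?L \<omega>) - exp (- s * D r \<omega>) = 0"
    using int_L integrable_exp_D[OF s(1), of r] r nonneg
    by (subst (asm) integral_nonneg_eq_0_iff_AE) auto
  then show ?thesis
    by eventually_elim (use s in simp)
qed

lemma prob_increments:
  fixes a :: "nat \<Rightarrow> real"
  assumes a: "a 0 = 0" "\<And>i. a i < a (Suc i)" and A: "\<And>i. A i \<in> sets borel"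
  shows "prob {\<omega>\<in>space M. \<forall>i<n. left_lim (\<lambda>t. D t \<omega>) (a (Suc i)) - left_lim (\<lambda>t. D t \<omega>) (a i) \<in> A i} =
    (\<Prod>i<n. prob {\<omega>\<in>space M. left_lim (\<lambda>t. D t \<omega>) (a (Suc i) - a i) \<in> A i})"
proof -
  have sm: "strict_mono a"
    using a(2) by (rule strict_mono_Suc_iff[THEN iffD2, rule_format])
  then have a_nonneg: "0 \<le> a i" for i
    using strict_mono_less_eq[OF sm, of 0 i] a(1) by simp
  note [measurable] = A
  have [measurable]: "D (a i) \<in> borel_measurable M" for i
    using a_nonneg by (intro D_measurable)
  have [measurable]: "D (a (Suc i) - a i) \<in> borel_measurable M" for i
    using a(2)[of i] by (intro D_measurable) simp
  let ?\<Delta> = "\<lambda>i \<omega>. D (a (Suc i)) \<omega> - D (a i) \<omega>"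
  have "indep_vars (\<lambda>_. borel) ?\<Delta> {..<n}"
    using levy a(1) sm unfolding levy_process_def by (simp add: strict_mono_on_def strict_mono_def)
  have "AE \<omega> in M. \<forall>i. left_lim (\<lambda>t. D t \<omega>) (a i) = D (a i) \<omega>"
    using left_lim_eq[OF a_nonneg] by (simp add: AE_all_countable)
  then have "prob {\<omega>\<in>space M. \<forall>i<n. left_lim (\<lambda>t. D t \<omega>) (a (Suc i)) - left_lim (\<lambda>t. D t \<omega>) (a i) \<in> A i} =
      prob {\<omega>\<in>space M. \<forall>i<n. ?\<Delta> i \<omega> \<in> A i}"
    by (intro finite_measure_eq_AE) (auto elim!: eventually_mono)
  also have "\<dots> = (\<Prod>i<n. prob {\<omega>\<in>space M. ?\<Delta> i \<omega> \<in> A i})"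
  proof (cases "n = 0")
    case True
    then show ?thesis using prob_space by simp
  next
    case False
    have "prob (\<Inter>i\<in>{..<n}. ?\<Delta> i -` A i \<inter> space M) = (\<Prod>i<n. prob (?\<Delta> i -` A i \<inter> space M))"
      using False by (intro indep_varsD[OF \<open>indep_vars (\<lambda>_. borel) ?\<Delta> {..<n}\<close>]) (auto simp: A)
    moreover have "(\<Inter>i\<in>{..<n}. ?\<Delta> i -` A i \<inter> space M) = {\<omega>\<in>space M. \<forall>i<n. ?\<Delta> i \<omega> \<in> A i}"
      using False by auto
    moreover have "?\<Delta> i -` A i \<inter> space M = {\<omega>\<in>space M. ?\<Delta> i \<omega> \<in> A i}" for i
      by auto
    ultimately show ?thesis by simp
  qed
  also have "\<dots> = (\<Prod>i<n. prob {\<omega>\<in>space M. left_lim (\<lambda>t. D t \<omega>) (a (Suc i) - a i) \<in> A i})"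
  proof (rule prod.cong[OF refl])
    fix i
    have "prob {\<omega>\<in>space M. ?\<Delta> i \<omega> \<in> A i} = prob {\<omega>\<in>space M. D (a (Suc i) - a i) \<omega> \<in> A i}"
      using a_nonneg less_imp_le[OF a(2)] A by (rule levy_process_increment_measure[OF levy])
    also have "\<dots> = prob {\<omega>\<in>space M. left_lim (\<lambda>t. D t \<omega>) (a (Suc i) - a i) \<in> A i}"
      using left_lim_eq[of "a (Suc i) - a i"] less_imp_le[OF a(2)[of i]]
      by (intro finite_measure_eq_AE) (auto elim!: eventually_mono)
    finally show "prob {\<omega>\<in>space M. ?\<Delta> i \<omega> \<in> A i} =
        prob {\<omega>\<in>space M. left_lim (\<lambda>t. D t \<omega>) (a (Suc i) - a i) \<in> A i}" .
  qed
  finally show ?thesis .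
qed

text \<open>The law of the subordinator at an independent random time with law \<open>\<mu>\<close>.\<close>

definition subordinated :: "real measure \<Rightarrow> real measure" where
  "subordinated \<mu> = distr (\<mu> \<Otimes>\<^sub>M M) borel (\<lambda>(x, \<omega>). left_lim (\<lambda>t. D t \<omega>) x)"

lemma left_lim_pair_measurable:
  assumes [measurable_cong]: "sets \<mu> = sets borel"
  shows "(\<lambda>(x, \<omega>). left_lim (\<lambda>t. D t \<omega>) x) \<in> borel_measurable (\<mu> \<Otimes>\<^sub>M M)"
proof -
  have "(\<lambda>z. left_lim (\<lambda>t. D t (snd z)) (fst z)) \<in> borel_measurable (\<mu> \<Otimes>\<^sub>M M)"
  proof (rule measurable_left_lim)
    show "fst \<in> borel_measurable (\<mu> \<Otimes>\<^sub>M M)"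
      using measurable_fst[of \<mu> M] unfolding measurable_cong_sets[OF refl assms] .
  qed (intro measurable_compose[OF measurable_snd] D_measurable)
  then show ?thesis by (simp add: case_prod_beta)
qed

lemma sets_subordinated [simp, measurable_cong]: "sets (subordinated \<mu>) = sets borel"
  by (simp add: subordinated_def)

lemma real_distribution_subordinated:
  assumes "real_distribution \<mu>"
  shows "real_distribution (subordinated \<mu>)"
proof -
  interpret \<mu>: real_distribution \<mu> by fact
  interpret pair_prob_space \<mu> M ..
  show ?thesis
    unfolding subordinated_def
    by (rule real_distribution_distr) (rule left_lim_pair_measurable, simp)
qed

lemma emeasure_subordinated:
  assumes "real_distribution \<mu>" and A: "A \<in> sets borel"
  shows "emeasure (subordinated \<mu>) A = (\<integral>\<^sup>+x. emeasure M {\<omega>\<in>space M. left_lim (\<lambda>t. D t \<omega>) x \<in> A} \<partial>\<mu>)"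
    and "(\<lambda>x. emeasure M {\<omega>\<in>space M. left_lim (\<lambda>t. D t \<omega>) x \<in> A}) \<in> borel_measurable borel"
proof -
  interpret \<mu>: real_distribution \<mu> by fact
  note m = left_lim_pair_measurable[OF \<mu>.events_eq_borel]
  let ?B = "(\<lambda>(x, \<omega>). left_lim (\<lambda>t. D t \<omega>) x) -` A \<inter> space (\<mu> \<Otimes>\<^sub>M M)"
  have B: "?B \<in> sets (\<mu> \<Otimes>\<^sub>M M)"
    using m A by (rule measurable_sets)
  have sl: "Pair x -` ?B = {\<omega>\<in>space M. left_lim (\<lambda>t. D t \<omega>) x \<in> A}" for x
    by (auto simp: space_pair_measure)
  have "emeasure (subordinated \<mu>) A = emeasure (\<mu> \<Otimes>\<^sub>M M) ?B"
    unfolding subordinated_def by (rule emeasure_distr[OF m A])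
  also have "\<dots> = (\<integral>\<^sup>+x. emeasure M {\<omega>\<in>space M. left_lim (\<lambda>t. D t \<omega>) x \<in> A} \<partial>\<mu>)"
    using emeasure_pair_measure_alt[OF B] sl by simp
  finally show "emeasure (subordinated \<mu>) A = (\<integral>\<^sup>+x. emeasure M {\<omega>\<in>space M. left_lim (\<lambda>t. D t \<omega>) x \<in> A} \<partial>\<mu>)" .
  show "(\<lambda>x. emeasure M {\<omega>\<in>space M. left_lim (\<lambda>t. D t \<omega>) x \<in> A}) \<in> borel_measurable borel"
    using measurable_emeasure_Pair[OF B] sl by (simp cong: measurable_cong_sets)
qed

lemma AE_subordinated_pos:
  assumes "real_distribution \<mu>" and pos: "AE x in \<mu>. 0 < x"
  shows "AE y in subordinated \<mu>. 0 < y"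
proof -
  interpret \<mu>: real_distribution \<mu> by fact
  interpret pair_prob_space \<mu> M ..
  note m[measurable] = left_lim_pair_measurable[OF \<mu>.events_eq_borel]
  have "AE z in \<mu> \<Otimes>\<^sub>M M. 0 < (\<lambda>(x, \<omega>). left_lim (\<lambda>t. D t \<omega>) x) z"
  proof (rule AE_pair_measure)
    show "{z \<in> space (\<mu> \<Otimes>\<^sub>M M). 0 < (\<lambda>(x, \<omega>). left_lim (\<lambda>t. D t \<omega>) x) z} \<in> sets (\<mu> \<Otimes>\<^sub>M M)"
      by measurable
    show "AE x in \<mu>. AE \<omega> in M. 0 < (\<lambda>(x, \<omega>). left_lim (\<lambda>t. D t \<omega>) x) (x, \<omega>)"
      using pos
    proof eventually_elim
      case (elim x)
      show ?case
        using left_lim_eq[OF less_imp_le[OF elim]] D_pos[OF elim] by eventually_elim simp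
    qed
  qed
  then show ?thesis
    unfolding subordinated_def by (subst AE_distr_iff) auto
qed

text \<open>By Fubini the integral over paths at time \<open>x\<close> is
  \<open>exp (- x * f s)\<close>, as \<open>D\<close> has no jump at a fixed time. This is how
  exponents compose.\<close>

lemma laplace_subordinated:
  assumes "real_distribution \<mu>" and pos: "AE x in \<mu>. 0 < x" and s: "0 < s"
  shows "(LINT y|subordinated \<mu>. exp (- s * y)) = (LINT x|\<mu>. exp (- f s * x))"
proof -
  interpret \<mu>: real_distribution \<mu> by fact
  note m[measurable] = left_lim_pair_measurable[OF \<mu>.events_eq_borel]
  have m': "(\<lambda>(x, \<omega>). exp (- s * left_lim (\<lambda>t. D t \<omega>) x)) \<in> borel_measurable (\<mu> \<Otimes>\<^sub>M M)"
    using measurable_compose[OF m, of "\<lambda>y. exp (- s * y)" borel] by (simp add: case_prod_beta)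
  have meas: "(\<lambda>x. LINT \<omega>|M. exp (- s * left_lim (\<lambda>t. D t \<omega>) x)) \<in> borel_measurable \<mu>"
    using borel_measurable_lebesgue_integral[OF m'] by simp
  interpret pair_prob_space \<mu> M ..
  have int: "integrable (\<mu> \<Otimes>\<^sub>M M) (\<lambda>(x, \<omega>). exp (- s * left_lim (\<lambda>t. D t \<omega>) x))"
    using s m' by (intro P.integrable_const_bound[where B=1]) (auto simp: left_lim_nonneg)
  have "(LINT y|subordinated \<mu>. exp (- s * y)) = (LINT z|(\<mu> \<Otimes>\<^sub>M M). (\<lambda>(x, \<omega>). exp (- s * left_lim (\<lambda>t. D t \<omega>) x)) z)"
    unfolding subordinated_def by (subst integral_distr[OF m]) (auto simp: case_prod_beta')
  also have "\<dots> = (LINT x|\<mu>. LINT \<omega>|M. exp (- s * left_lim (\<lambda>t. D t \<omega>) x))"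
    using integral_fst'[OF int] by simp
  also have "\<dots> = (LINT x|\<mu>. exp (- f s * x))"
  proof (rule integral_cong_AE)
    show "(\<lambda>x. LINT \<omega>|M. exp (- s * left_lim (\<lambda>t. D t \<omega>) x)) \<in> borel_measurable \<mu>"
      by (rule meas)
    show "AE x in \<mu>. (LINT \<omega>|M. exp (- s * left_lim (\<lambda>t. D t \<omega>) x)) = exp (- f s * x)"
      using pos
    proof eventually_elim
      case (elim x)
      have [measurable]: "D x \<in> borel_measurable M" using elim by (intro D_measurable) simp
      have "(LINT \<omega>|M. exp (- s * left_lim (\<lambda>t. D t \<omega>) x)) = (LINT \<omega>|M. exp (- s * D x \<omega>))"
        using left_lim_eq[of x] elim by (intro integral_cong_AE) (auto elim!: eventually_mono)
      then show ?case
        using laplace[OF s, of x] elim by (simp add: mult.commute)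
    qed
  qed simp
  finally show ?thesis .
qed

end

section \<open>Arrival times of renewal processes\<close>

lemma downward_closed_eq_atLeastAtMost_card:
  assumes "finite F" and "F \<subseteq> {1..}" and down: "\<And>m n. n \<in> F \<Longrightarrow> 1 \<le> m \<Longrightarrow> m \<le> n \<Longrightarrow> m \<in> F"
  shows "F = {1..card F :: nat}"
proof (cases "F = {}")
  case False
  then have "F = {1..Max F}"
    using Max_ge[OF assms(1)] assms(2) down[OF Max_in[OF assms(1)]] by fastforce
  then show ?thesis
    by (metis card_atLeastAtMost diff_Suc_1)
qed simp

text \<open>Positive gaps make the set of arrivals up to \<open>t\<close> an initial segment, which
  its cardinality \<open>X t\<close> determines. The counting formula thereby becomes a duality of
  the same kind as the one between \<open>D\<close> and its inverse.\<close>

lemma renewal_process_arrivals: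
  assumes R: "renewal_process M X G"
  defines "T \<equiv> \<lambda>n \<omega>. \<Sum>k=1..n. G k \<omega>"
  shows "AE \<omega> in M. (\<forall>n. T n \<omega> < T (Suc n) \<omega>) \<and> (\<forall>t\<ge>0. \<forall>n\<ge>1. T n \<omega> \<le> t \<longleftrightarrow> n \<le> X t \<omega>)"
proof -
  have "AE \<omega> in M. \<forall>n\<ge>1. 0 < G n \<omega>"
    using R by (subst AE_all_countable) (auto simp: renewal_process_def)
  moreover have "AE \<omega> in M. \<forall>t\<ge>0. finite {n. 1 \<le> n \<and> T n \<omega> \<le> t} \<and> X t \<omega> = card {n. 1 \<le> n \<and> T n \<omega> \<le> t}"
    using R by (simp add: renewal_process_def T_def)
  ultimately show ?thesis
  proof eventually_elim
    case (elim \<omega>)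
    have step: "T n \<omega> < T (Suc n) \<omega>" for n
      using elim(1) by (simp add: T_def)
    then have mono: "T m \<omega> \<le> T n \<omega>" if "m \<le> n" for m n
      using lift_Suc_mono_le[of "\<lambda>n. T n \<omega>", OF less_imp_le] that by blast
    have "T n \<omega> \<le> t \<longleftrightarrow> n \<le> X t \<omega>" if "0 \<le> t" "1 \<le> n" for t n
    proof -
      have "{n. 1 \<le> n \<and> T n \<omega> \<le> t} = {1..X t \<omega>}"
      proof -
        have "{n. 1 \<le> n \<and> T n \<omega> \<le> t} = {1..card {n. 1 \<le> n \<and> T n \<omega> \<le> t}}"
          by (rule downward_closed_eq_atLeastAtMost_card)
             (use elim(2) that(1) in \<open>auto intro: order_trans[OF mono]\<close>)
        then show ?thesis using elim(2) that(1) by simp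
      qed
      then show ?thesis using that(2) by (auto simp: set_eq_iff)
    qed
    with step show ?case by blast
  qed
qed

context unbounded_subordinator
begin

text \<open>Fubini for the two path laws freezes the times \<open>T i\<close>. The inner probability
  is then a product of functions \<open>K i\<close> of the separate gaps, and independence of the
  gaps \<open>G i\<close> factors the outer integral.\<close>

lemma renewal_time_change:
  assumes R: "renewal_process M X G"
    and ind: "indep_processes M (\<lambda>t \<omega>. real (X t \<omega>)) (inverse_subordinator D)"
  shows "\<exists>J. renewal_process M (\<lambda>t \<omega>. X (inverse_subordinator D t \<omega>) \<omega>) J \<and>
    (\<forall>n\<ge>1. distr M borel (J n) = subordinated (distr M borel (G 1)))"
proof -
  let ?L = "\<lambda>\<omega>. left_lim (\<lambda>t. D t \<omega>)"
  let ?P = "PiM {0::real..} (\<lambda>_. borel :: real measure)"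
  let ?\<mu> = "distr M borel (G 1)"
  have G_ind: "indep_vars (\<lambda>_. borel) G {1..}"
    using R unfolding renewal_process_def by (elim conjE)
  have G_distr: "distr M borel (G n) = ?\<mu>" if "1 \<le> n" for n
    using R that unfolding renewal_process_def by blast
  have G_pos: "AE \<omega> in M. 0 < G n \<omega>" if "1 \<le> n" for n
    using R that by (simp add: renewal_process_def)
  have G_meas: "G n \<in> borel_measurable M" if "1 \<le> n" for n
    using G_ind that by (auto simp: indep_vars_def)
  have \<mu>: "real_distribution ?\<mu>"
    by (rule real_distribution_distr) (rule G_meas, simp)
  have \<mu>_pos: "AE x in ?\<mu>. 0 < x"
    using G_pos[of 1] G_meas[of 1] by (subst AE_distr_iff) auto
  interpret law: real_distribution "subordinated ?\<mu>"
    by (rule real_distribution_subordinated[OF \<mu>])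
  define T where "T n \<omega> = (\<Sum>k=1..n. G k \<omega>)" for n \<omega>
  define J where "J n \<omega> = ?L \<omega> (T n \<omega>) - ?L \<omega> (T (n - 1) \<omega>)" for n \<omega>
  have T_meas [measurable]: "T n \<in> borel_measurable M" for n
    unfolding T_def using G_meas by (intro borel_measurable_sum) simp
  have J_meas [measurable]: "J n \<in> borel_measurable M" for n
    unfolding J_def by measurable
  have T_0: "T 0 \<omega> = 0" for \<omega>
    by (simp add: T_def)
  have arr: "AE \<omega> in M. (\<forall>n. T n \<omega> < T (Suc n) \<omega>) \<and> (\<forall>t\<ge>0. \<forall>n\<ge>1. T n \<omega> \<le> t \<longleftrightarrow> n \<le> X t \<omega>)"
    using renewal_process_arrivals[OF R] by (simp add: T_def)
  let ?C = "completion M"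
  \<comment> \<open>Independence concerns whole paths as random elements over the completion; almost
    sure facts are transferred there by \<open>AE_completion\<close>.\<close>
  define XP where "XP \<omega> = (\<lambda>t\<in>{0..}. real (X t \<omega>))" for \<omega>
  define EP where "EP \<omega> = (\<lambda>t\<in>{0..}. inverse_subordinator D t \<omega>)" for \<omega>
  interpret C: prob_space ?C
    by (rule prob_space_completion)
  have "C.indep_var ?P XP ?P EP"
    using ind unfolding indep_processes_def XP_def EP_def .
  then have XP[measurable]: "XP \<in> ?C \<rightarrow>\<^sub>M ?P" and EP[measurable]: "EP \<in> ?C \<rightarrow>\<^sub>M ?P"
    and prod: "distr ?C ?P XP \<Otimes>\<^sub>M distr ?C ?P EP = distr ?C (?P \<Otimes>\<^sub>M ?P) (\<lambda>\<omega>. (XP \<omega>, EP \<omega>))"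
    unfolding C.indep_var_distribution_eq by blast+
  interpret XL: prob_space "distr ?C ?P XP" by (rule C.prob_space_distr[OF XP])
  interpret EL: prob_space "distr ?C ?P EP" by (rule C.prob_space_distr[OF EP])
  \<comment> \<open>Functionals on path space: \<open>\<tau> i\<close> recovers the
    \<open>i\<close>-th arrival time from the path of \<open>X\<close>, and \<open>ll\<close> the
    left limits of \<open>D\<close> from the path of its inverse. Only rational times occur, which
    makes them measurable.\<close>
  define \<tau> where "\<tau> i x = ratsup (\<lambda>q. x q < real i)" for i and x :: "real \<Rightarrow> real"
  define ll where "ll e r = ratsup (\<lambda>q. e q < r)" for e :: "real \<Rightarrow> real" and r
  have \<tau>_eq: "\<tau> n (XP \<omega>) = T n \<omega>"
    if "(\<forall>n. T n \<omega> < T (Suc n) \<omega>) \<and> (\<forall>t\<ge>0. \<forall>n\<ge>1. T n \<omega> \<le> t \<longleftrightarrow> n \<le> X t \<omega>)" for n \<omega>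
  proof (cases "n = 0")
    case True
    then show ?thesis
      unfolding \<tau>_def XP_def T_0 True by (intro ratsup_eqI) auto
  next
    case False
    have "T 0 \<omega> \<le> T n \<omega>"
      using that lift_Suc_mono_le[of "\<lambda>n. T n \<omega>" 0 n] by (simp add: less_imp_le)
    moreover have "XP \<omega> q < real n \<longleftrightarrow> q < T n \<omega>" if "0 \<le> q" for q
    proof -
      have "T n \<omega> \<le> q \<longleftrightarrow> n \<le> X q \<omega>"
        using False that \<open>_ \<and> _\<close> by simp
      then show ?thesis using that by (auto simp: XP_def not_le)
    qed
    ultimately show ?thesis
      unfolding \<tau>_def T_0 by (intro ratsup_eqI) auto
  qed
  have ll_eq: "ll (EP \<omega>) r = ?L \<omega> r" if "subordinator_path (\<lambda>t. D t \<omega>)" for \<omega> r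
  proof -
    have "ratsup (\<lambda>q. EP \<omega> q < r) = ratsup (\<lambda>q. inverse_subordinator D q \<omega> < r)"
      unfolding ratsup_def EP_def by (intro arg_cong[where f=enn2real] SUP_cong) auto
    then show ?thesis
      using ratsup_inverse_subordinator[where D=D and \<omega>=\<omega>, OF that] by (simp add: ll_def)
  qed
  have \<tau>_meas: "\<tau> i \<in> borel_measurable ?P" for i
    unfolding \<tau>_def by (rule measurable_ratsup) measurable
  have fst_q: "(\<lambda>z. fst z q) \<in> borel_measurable (?P \<Otimes>\<^sub>M ?P)" "(\<lambda>z. snd z q) \<in> borel_measurable (?P \<Otimes>\<^sub>M ?P)"
    if "0 \<le> q" for q :: real
    using that by (auto intro!: measurable_compose[OF measurable_fst] measurable_compose[OF measurable_snd]
        measurable_component_singleton)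
  have ll_meas [measurable]: "(\<lambda>z. ll (snd z) (\<tau> i (fst z))) \<in> borel_measurable (?P \<Otimes>\<^sub>M ?P)" for i
    unfolding ll_def
  proof (rule measurable_ratsup)
    fix q :: real assume "0 \<le> q"
    note [measurable] = fst_q[OF this] measurable_compose[OF measurable_fst \<tau>_meas]
    show "Measurable.pred (?P \<Otimes>\<^sub>M ?P) (\<lambda>z. snd z q < \<tau> i (fst z))"
      by measurable
  qed
  have joint: "prob {\<omega>\<in>space M. \<forall>i<n. J (Suc i) \<omega> \<in> A i} = (\<Prod>i<n. measure (subordinated ?\<mu>) (A i))"
    if A[measurable]: "\<And>i. A i \<in> sets borel" for A :: "nat \<Rightarrow> real set" and n
  proof -
    define B where "B = {z\<in>space (?P \<Otimes>\<^sub>M ?P). \<forall>i<n.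
        ll (snd z) (\<tau> (Suc i) (fst z)) - ll (snd z) (\<tau> i (fst z)) \<in> A i}"
    have B: "B \<in> sets (?P \<Otimes>\<^sub>M ?P)"
      unfolding B_def by measurable
    define K where "K i r = emeasure M {\<omega>\<in>space M. ?L \<omega> r \<in> A i}" for i r
    have K_meas [measurable]: "K i \<in> borel_measurable borel" for i
      unfolding K_def by (rule emeasure_subordinated(2)[OF \<mu> A])
    have XP_sp: "XP \<omega> \<in> space ?P" "EP \<omega> \<in> space ?P" for \<omega>
      by (auto simp: XP_def EP_def space_PiM)
    \<comment> \<open>The path of \<open>X\<close> is frozen at \<open>\<omega>\<close> while the
      subordinator runs over an independent \<open>\<omega>'\<close>. The times
      \<open>T i \<omega>\<close> are now deterministic, so \<open>prob_increments\<close>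
      applies.\<close>
    have slice: "emeasure (distr ?C ?P EP) (Pair (XP \<omega>) -` B) = (\<Prod>i<n. K i (G (Suc i) \<omega>))"
      if \<omega>: "(\<forall>n. T n \<omega> < T (Suc n) \<omega>) \<and> (\<forall>t\<ge>0. \<forall>n\<ge>1. T n \<omega> \<le> t \<longleftrightarrow> n \<le> X t \<omega>)" for \<omega>
    proof -
      have S: "Pair (XP \<omega>) -` B \<in> sets ?P"
        using B by (rule sets_Pair1)
      let ?E = "{\<omega>'\<in>space M. \<forall>i<n. ?L \<omega>' (T (Suc i) \<omega>) - ?L \<omega>' (T i \<omega>) \<in> A i}"
      have E: "?E \<in> sets M" by measurable
      have "emeasure (distr ?C ?P EP) (Pair (XP \<omega>) -` B) = emeasure ?C (EP -` (Pair (XP \<omega>) -` B) \<inter> space ?C)"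
        by (rule emeasure_distr[OF EP S])
      also have "\<dots> = emeasure ?C ?E"
      proof (rule emeasure_eq_AE)
        show "EP -` (Pair (XP \<omega>) -` B) \<inter> space ?C \<in> sets ?C"
          using EP S by (rule measurable_sets)
        show "?E \<in> sets ?C" using E by simp
        show "AE \<omega>' in ?C. \<omega>' \<in> EP -` (Pair (XP \<omega>) -` B) \<inter> space ?C \<longleftrightarrow> \<omega>' \<in> ?E"
          using AE_completion[OF path]
          by eventually_elim (auto simp: B_def space_pair_measure XP_sp ll_eq \<tau>_eq[OF \<omega>])
      qed
      also have "\<dots> = emeasure M ?E" using E by simp
      also have "\<dots> = ennreal (\<Prod>i<n. prob {\<omega>'\<in>space M. ?L \<omega>' (T (Suc i) \<omega> - T i \<omega>) \<in> A i})"
        unfolding emeasure_eq_measure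
        using \<omega> by (subst prob_increments) (auto simp: T_0)
      also have "\<dots> = (\<Prod>i<n. K i (G (Suc i) \<omega>))"
        unfolding K_def emeasure_eq_measure by (simp add: prod_ennreal T_def)
      finally show ?thesis .
    qed
    let ?F = "{\<omega>\<in>space M. \<forall>i<n. J (Suc i) \<omega> \<in> A i}"
    have F: "?F \<in> sets M" by measurable
    have "emeasure M ?F = emeasure ?C ?F"
      using F by simp
    also have "\<dots> = emeasure ?C ((\<lambda>\<omega>. (XP \<omega>, EP \<omega>)) -` B \<inter> space ?C)"
    proof (rule emeasure_eq_AE)
      show "(\<lambda>\<omega>. (XP \<omega>, EP \<omega>)) -` B \<inter> space ?C \<in> sets ?C"
        using B by measurable
      show "?F \<in> sets ?C" using F by simp
      show "AE \<omega> in ?C. \<omega> \<in> ?F \<longleftrightarrow> \<omega> \<in> (\<lambda>\<omega>. (XP \<omega>, EP \<omega>)) -` B \<inter> space ?C"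
        using AE_completion[OF path] AE_completion[OF arr]
      proof eventually_elim
        case (elim \<omega>)
        show ?case
          by (auto simp: B_def space_pair_measure XP_sp ll_eq[OF elim(1)] \<tau>_eq[OF elim(2)] J_def)
      qed
    qed
    also have "\<dots> = emeasure (distr ?C ?P XP \<Otimes>\<^sub>M distr ?C ?P EP) B"
      unfolding prod by (rule emeasure_distr[symmetric, OF _ B]) measurable
    also have "\<dots> = (\<integral>\<^sup>+x. emeasure (distr ?C ?P EP) (Pair x -` B) \<partial>distr ?C ?P XP)"
      using B by (intro EL.emeasure_pair_measure_alt) (simp cong: sets_pair_measure_cong)
    also have "\<dots> = (\<integral>\<^sup>+\<omega>. emeasure (distr ?C ?P EP) (Pair (XP \<omega>) -` B) \<partial>?C)"
      using EL.measurable_emeasure_Pair[of B ?P] B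
      by (intro nn_integral_distr[OF XP]) (simp cong: sets_pair_measure_cong)
    also have "\<dots> = (\<integral>\<^sup>+\<omega>. (\<Prod>i<n. K i (G (Suc i) \<omega>)) \<partial>?C)"
      by (rule nn_integral_cong_AE) (use AE_completion[OF arr] slice in \<open>rule eventually_mono\<close>)
    also have "\<dots> = (\<integral>\<^sup>+\<omega>. (\<Prod>i\<in>{1..n}. K (i - 1) (G i \<omega>)) \<partial>M)"
      unfolding nn_integral_completion
      by (intro nn_integral_cong prod.reindex_bij_witness[of _ "\<lambda>i. i - 1" Suc]) auto
    also have "\<dots> = (\<Prod>i\<in>{1..n}. \<integral>\<^sup>+\<omega>. K (i - 1) (G i \<omega>) \<partial>M)"
    proof (rule indep_vars_nn_integral)
      show "indep_vars (\<lambda>_. borel) (\<lambda>i \<omega>. K (i - 1) (G i \<omega>)) {1..n}"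
        by (rule indep_vars_compose2[OF indep_vars_subset[OF G_ind]]) auto
    qed auto
    also have "\<dots> = (\<Prod>i\<in>{1..n}. emeasure (subordinated ?\<mu>) (A (i - 1)))"
    proof (rule prod.cong[OF refl])
      fix i assume i: "i \<in> {1..n}"
      have "(\<integral>\<^sup>+\<omega>. K (i - 1) (G i \<omega>) \<partial>M) = (\<integral>\<^sup>+x. K (i - 1) x \<partial>distr M borel (G i))"
        using G_meas[of i] i by (subst nn_integral_distr) auto
      also have "\<dots> = (\<integral>\<^sup>+x. K (i - 1) x \<partial>?\<mu>)"
        using G_distr[of i] i by simp
      also have "\<dots> = emeasure (subordinated ?\<mu>) (A (i - 1))"
        unfolding K_def by (rule emeasure_subordinated(1)[OF \<mu> A, symmetric])
      finally show "(\<integral>\<^sup>+\<omega>. K (i - 1) (G i \<omega>) \<partial>M) = emeasure (subordinated ?\<mu>) (A (i - 1))" .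
    qed
    also have "\<dots> = (\<Prod>i<n. emeasure (subordinated ?\<mu>) (A i))"
      by (intro prod.reindex_bij_witness[of _ Suc "\<lambda>i. i - 1"]) auto
    finally show ?thesis
      by (simp add: emeasure_eq_measure law.emeasure_eq_measure prod_ennreal prod_nonneg del: One_nat_def)
  qed
  have single: "prob {\<omega>\<in>space M. J (Suc n) \<omega> \<in> A} = measure (subordinated ?\<mu>) A"
    if A: "A \<in> sets borel" for A n
  proof -
    \<comment> \<open>The earlier gaps are left unconstrained and contribute factors 1, which
      isolates the law of one gap.\<close>
    define A' where "A' i = (if i = n then A else UNIV)" for i
    have "prob {\<omega>\<in>space M. \<forall>i<Suc n. J (Suc i) \<omega> \<in> A' i} = (\<Prod>i<Suc n. measure (subordinated ?\<mu>) (A' i))"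
      by (rule joint) (auto simp: A'_def A)
    moreover have "{\<omega>\<in>space M. \<forall>i<Suc n. J (Suc i) \<omega> \<in> A' i} = {\<omega>\<in>space M. J (Suc n) \<omega> \<in> A}"
      by (auto simp: A'_def)
    moreover have "(\<Prod>i<n. measure (subordinated ?\<mu>) (A' i)) = 1"
      using law.prob_space law.space_eq_univ by (intro prod.neutral) (auto simp: A'_def)
    ultimately show ?thesis by (simp add: A'_def del: One_nat_def)
  qed
  have J_distr: "distr M borel (J n) = subordinated ?\<mu>" if n: "1 \<le> n" for n
  proof (rule measure_eqI)
    obtain m where m: "n = Suc m" using n by (cases n) auto
    fix A assume "A \<in> sets (distr M borel (J n))"
    then have A: "A \<in> sets borel" by simp
    have "emeasure (distr M borel (J n)) A = emeasure M {\<omega>\<in>space M. J (Suc m) \<omega> \<in> A}"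
      using A by (subst emeasure_distr) (auto simp: m intro!: arg_cong[where f="emeasure M"])
    then show "emeasure (distr M borel (J n)) A = emeasure (subordinated ?\<mu>) A"
      using single[OF A] by (simp add: emeasure_eq_measure law.emeasure_eq_measure del: One_nat_def)
  qed simp
  have "renewal_process M (\<lambda>t \<omega>. X (inverse_subordinator D t \<omega>) \<omega>) J"
    unfolding renewal_process_def
  proof (intro conjI allI impI)
    show "prob_space M" by (rule prob_space_axioms)
    show "indep_vars (\<lambda>_. borel) J {1..}"
    proof (rule indep_vars_atLeast_oneI)
      fix n and A :: "nat \<Rightarrow> real set" assume A: "\<And>i. A i \<in> sets borel"
      have "{\<omega>\<in>space M. \<forall>i\<in>{1..n}. J i \<omega> \<in> A i} = {\<omega>\<in>space M. \<forall>i<n. J (Suc i) \<omega> \<in> A (Suc i)}"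
        by (auto simp: Ball_def) (metis Suc_le_D Suc_le_eq)
      moreover have "(\<Prod>i=1..n. prob {\<omega>\<in>space M. J i \<omega> \<in> A i}) = (\<Prod>i<n. prob {\<omega>\<in>space M. J (Suc i) \<omega> \<in> A (Suc i)})"
        by (intro prod.reindex_bij_witness[of _ Suc "\<lambda>i. i - 1"]) auto
      ultimately show "prob {\<omega>\<in>space M. \<forall>i\<in>{1..n}. J i \<omega> \<in> A i} = (\<Prod>i=1..n. prob {\<omega>\<in>space M. J i \<omega> \<in> A i})"
        using joint[of "\<lambda>i. A (Suc i)" n] single A by (simp del: One_nat_def)
    qed simp
    show "distr M borel (J n) = distr M borel (J 1)" if "1 \<le> n" for n
      using J_distr[OF that] J_distr[of 1] by simp
    show "AE \<omega> in M. 0 < J n \<omega>" if "1 \<le> n" for n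
    proof -
      have "AE y in distr M borel (J n). 0 < y"
        unfolding J_distr[OF that] by (rule AE_subordinated_pos[OF \<mu> \<mu>_pos])
      then show ?thesis by (subst (asm) AE_distr_iff) auto
    qed
    have "AE \<omega> in M. \<forall>t\<ge>0. finite {n. 1 \<le> n \<and> (\<Sum>k=1..n. J k \<omega>) \<le> t} \<and>
        X (inverse_subordinator D t \<omega>) \<omega> = card {n. 1 \<le> n \<and> (\<Sum>k=1..n. J k \<omega>) \<le> t}"
      using arr path
    proof eventually_elim
      case (elim \<omega>)
      show ?case
      proof (intro allI impI)
        fix t :: real assume t: "0 \<le> t"
        note E = inverse_subordinator_nonneg[where D=D and \<omega>=\<omega>, OF elim(2) t]
        \<comment> \<open>The gaps telescope to the left limit at \<open>T n\<close>, which is at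
          most \<open>t\<close> exactly if \<open>T n\<close> is at most the inverse at
          \<open>t\<close>.\<close>
        have "(\<Sum>k=1..n. J k \<omega>) = ?L \<omega> (T n \<omega>)" for n
          by (induction n) (auto simp: J_def T_0)
        then have "{n. 1 \<le> n \<and> (\<Sum>k=1..n. J k \<omega>) \<le> t} = {n. 1 \<le> n \<and> T n \<omega> \<le> inverse_subordinator D t \<omega>}"
          using le_inverse_subordinator_iff[where D=D and \<omega>=\<omega>, OF elim(2) t] by simp
        also have "\<dots> = {1..X (inverse_subordinator D t \<omega>) \<omega>}"
          using elim(1) E by auto
        finally have eq: "{n. 1 \<le> n \<and> (\<Sum>k=1..n. J k \<omega>) \<le> t} = {1..X (inverse_subordinator D t \<omega>) \<omega>}" .
        show "finite {n. 1 \<le> n \<and> (\<Sum>k=1..n. J k \<omega>) \<le> t} \<and>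
            X (inverse_subordinator D t \<omega>) \<omega> = card {n. 1 \<le> n \<and> (\<Sum>k=1..n. J k \<omega>) \<le> t}"
          unfolding eq by simp
      qed
    qed
    then show "AE \<omega> in M. \<forall>t\<ge>0. finite {n. 1 \<le> n \<and> (\<Sum>k=1..n. J k \<omega>) \<le> t} \<and>
        X (inverse_subordinator D t \<omega>) \<omega> = card {n. 1 \<le> n \<and> (\<Sum>k=1..n. J k \<omega>) \<le> t}" .
  qed
  with J_distr show ?thesis by blast
qed

end

section \<open>The fractional Poisson process with an inverse subordinator\<close>

lemma filterlim_powr_at_top:
  assumes "0 < (\<beta>::real)"
  shows "filterlim (\<lambda>x::real. x powr \<beta>) at_top at_top"
proof -
  have "filterlim (\<lambda>x::real. exp (\<beta> * ln x)) at_top at_top"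
    using assms by (intro filterlim_compose[OF exp_at_top] filterlim_tendsto_pos_mult_at_top[OF tendsto_const] ln_at_top)
  moreover have "\<forall>\<^sub>F x::real in at_top. exp (\<beta> * ln x) = x powr \<beta>"
    using eventually_gt_at_top[of 0] by eventually_elim (simp add: powr_def)
  ultimately show ?thesis
    by (rule filterlim_cong[OF refl refl, THEN iffD1, rotated])
qed

lemma set_integrable_one_minus_exp:
  assumes \<nu>: "subordinator_levy_measure \<nu>" and s: "0 \<le> s"
  shows "set_integrable \<nu> {0<..} (\<lambda>x. 1 - exp (- s * x))"
proof -
  have [measurable_cong]: "sets \<nu> = sets borel"
    using \<nu> by (simp add: subordinator_levy_measure_def)
  have "(\<integral>\<^sup>+x. ennreal (indicator {0<..} x * min x 1) \<partial>\<nu>) < \<infinity>"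
  proof -
    have "(\<integral>\<^sup>+x. ennreal (indicator {0<..} x * min x 1) \<partial>\<nu>) = (\<integral>\<^sup>+x\<in>{0<..}. ennreal (min x 1) \<partial>\<nu>)"
      by (intro nn_integral_cong) (auto simp: indicator_def)
    then show ?thesis
      using \<nu> by (simp add: subordinator_levy_measure_def)
  qed
  then have "integrable \<nu> (\<lambda>x. indicator {0<..} x * min x 1 :: real)"
    by (intro integrableI_nonneg) (auto simp: indicator_def)
  \<comment> \<open>The dominating function: \<open>1 - exp (- s * x)\<close> is at most
    \<open>s * x\<close> and at most 1, hence at most \<open>max 1 s * min x 1\<close>.\<close>
  then have "integrable \<nu> (\<lambda>x. max 1 s * (indicator {0<..} x * min x 1))"
    by (rule integrable_mult_right)
  then show ?thesis
    unfolding set_integrable_def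
  proof (rule Bochner_Integration.integrable_bound)
    have bound: "1 - exp (- s * x) \<le> max 1 s * min x 1" "0 \<le> 1 - exp (- s * x)" if "0 < x" for x
    proof -
      have le: "1 - exp (- s * x) \<le> max 1 s * x" "1 - exp (- s * x) \<le> max 1 s * 1"
      proof -
        have "1 - exp (- s * x) \<le> s * x"
          using exp_ge_add_one_self[of "- s * x"] by simp
        also have "\<dots> \<le> max 1 s * x"
          using that by (intro mult_right_mono) auto
        finally show "1 - exp (- s * x) \<le> max 1 s * x" .
        have "1 - exp (- s * x) \<le> 1"
          by simp
        then show "1 - exp (- s * x) \<le> max 1 s * 1"
          by linarith
      qed
      then show "1 - exp (- s * x) \<le> max 1 s * min x 1"
        by (simp only: min_def split: if_split) simp
      show "0 \<le> 1 - exp (- s * x)"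
        using s that by simp
    qed
    show "AE x in \<nu>. norm (indicator {0<..} x *\<^sub>R (1 - exp (- s * x))) \<le> norm (max 1 s * (indicator {0<..} x * min x 1))"
    proof (rule AE_I2)
      fix x
      show "norm (indicator {0<..} x *\<^sub>R (1 - exp (- s * x))) \<le> norm (max 1 s * (indicator {0<..} x * min x 1))"
        using bound[of x] by (cases "0 < x") (simp_all add: indicator_def)
    qed
  qed measurable
qed

lemma bernstein_fun_nonneg:
  assumes "subordinator_levy_measure \<nu>" "0 \<le> b" "0 \<le> s"
  shows "0 \<le> bernstein_fun b \<nu> s"
  unfolding bernstein_fun_def set_lebesgue_integral_def
  using assms by (intro add_nonneg_nonneg Bochner_Integration.integral_nonneg mult_nonneg_nonneg) (auto simp: indicator_def)

text \<open>Monotone convergence: \<open>1 - exp (- k * x)\<close> increases to 1 for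
  \<open>x > 0\<close>, so the integrals increase to the infinite mass of \<open>{0<..}\<close>. The
  drift adds a nonnegative term.\<close>

lemma bernstein_fun_at_top:
  assumes \<nu>: "subordinator_levy_measure \<nu>" and inf: "emeasure \<nu> {0<..} = \<infinity>" and b: "0 \<le> b"
  shows "filterlim (\<lambda>k. bernstein_fun b \<nu> (real k)) at_top sequentially"
proof -
  have [measurable_cong]: "sets \<nu> = sets borel"
    using \<nu> by (simp add: subordinator_levy_measure_def)
  define h where "h k x = indicator {0<..} x *\<^sub>R (1 - exp (- real k * x))" for k :: nat and x :: real
  have h_nonneg: "0 \<le> h k x" for k x
    by (simp add: h_def indicator_def)
  have h_int: "integrable \<nu> (h k)" for k
    using set_integrable_one_minus_exp[OF \<nu>, of "real k"] unfolding set_integrable_def h_def by simp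
  have "(\<lambda>k. \<integral>\<^sup>+x. ennreal (h k x) \<partial>\<nu>) \<longlonglongrightarrow> (\<integral>\<^sup>+x. indicator {0<..} x \<partial>\<nu>)"
  proof (rule nn_integral_LIMSEQ)
    show "incseq (\<lambda>k x. ennreal (h k x))"
      by (intro incseq_SucI le_funI ennreal_leI) (auto simp: h_def indicator_def algebra_simps)
    show "(\<lambda>x. ennreal (h k x)) \<in> borel_measurable \<nu>" for k
      unfolding h_def by measurable
    show "(\<lambda>k. ennreal (h k x)) \<longlonglongrightarrow> indicator {0<..} x" for x
    proof (cases "0 < x")
      case True
      have "filterlim (\<lambda>k. x * real k) at_top sequentially"
        using True by (intro filterlim_tendsto_pos_mult_at_top[OF tendsto_const] filterlim_real_sequentially)
      then have "filterlim (\<lambda>k. - real k * x) at_bot sequentially"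
        by (simp add: filterlim_uminus_at_bot mult.commute)
      then have "(\<lambda>k. ennreal (1 - exp (- real k * x))) \<longlonglongrightarrow> ennreal (1 - 0)"
        by (intro tendsto_ennrealI tendsto_diff tendsto_const filterlim_compose[OF exp_at_bot])
      then show ?thesis using True by (simp add: h_def)
    qed (simp add: h_def)
  qed
  also have "(\<integral>\<^sup>+x. indicator {0<..} x \<partial>\<nu>) = top"
    using inf by simp
  finally have "(\<lambda>k. ennreal (LINT x|\<nu>. h k x)) \<longlonglongrightarrow> top"
    using h_nonneg h_int by (simp add: nn_integral_eq_integral)
  then have "filterlim (\<lambda>k. LINT x|\<nu>. h k x) at_top sequentially"
    by (simp add: ennreal_tendsto_top_eq_at_top)
  then show ?thesis
    by (rule filterlim_at_top_mono) (use b in \<open>auto simp: bernstein_fun_def set_lebesgue_integral_def h_def\<close>)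
qed

section \<open>Exponential waiting times\<close>

lemma real_distribution_exponential:
  assumes "0 < l"
  shows "real_distribution (density lborel (exponential_density l))"
  using prob_space_exponential_density[OF assms]
  by (simp add: real_distribution_def real_distribution_axioms_def)

lemma AE_exponential_pos: "AE x in density lborel (exponential_density l). 0 < x"
proof -
  have "AE x in lborel. x \<noteq> (0::real)"
    by (rule AE_lborel_singleton)
  then show ?thesis
    by (subst AE_density) (auto elim!: eventually_mono simp: exponential_density_def ennreal_neg)
qed

lemma emeasure_exponential_greaterThan:
  assumes l: "0 < l" and e: "0 \<le> e"
  shows "emeasure (density lborel (exponential_density l)) {e<..} = ennreal (exp (- l * e))"
proof -
  interpret real_distribution "density lborel (exponential_density l)"
    by (rule real_distribution_exponential[OF l])
  have "distributed (density lborel (exponential_density l)) lborel (\<lambda>x. x) (exponential_density l)"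
    using l by (simp add: distributed_def distr_id2)
  from exponential_distributedD_gt[OF this e l] show ?thesis
    by (simp add: emeasure_eq_measure greaterThan_def mult.commute)
qed

lemma laplace_exponential:
  assumes l: "0 < l" and c: "0 \<le> c"
  shows "(LINT x|density lborel (exponential_density l). exp (- c * x)) = l / (l + c)"
proof -
  have nonneg: "AE x in lborel. 0 \<le> exponential_density r x" if "0 < r" for r
    using exponential_density_nonneg[OF that] by simp
  have one: "(LINT x|lborel. exponential_density r x) = 1" if "0 < r" for r
  proof -
    interpret prob_space "density lborel (exponential_density r)"
      by (rule prob_space_exponential_density[OF that])
    have "(LINT x|density lborel (exponential_density r). 1) = (1::real)"
      using prob_space by simp
    then show ?thesis
      using integral_density[of "\<lambda>_. 1::real" lborel "exponential_density r"] nonneg[OF that] by simp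
  qed
  have "(LINT x|density lborel (exponential_density l). exp (- c * x)) =
      (LINT x|lborel. exponential_density l x * exp (- c * x))"
    using nonneg[OF l] by (subst integral_density) auto
  \<comment> \<open>Weighting by \<open>exp (- c * x)\<close> turns rate \<open>l\<close> into rate
    \<open>l + c\<close>, up to the factor \<open>l / (l + c)\<close>.\<close>
  also have "\<dots> = (LINT x|lborel. l / (l + c) * exponential_density (l + c) x)"
    using l c by (intro Bochner_Integration.integral_cong)
      (auto simp: exponential_density_def exp_add[symmetric] algebra_simps divide_simps)
  also have "\<dots> = l / (l + c)"
    using one[of "l + c"] l c by simp
  finally show ?thesis .
qed

text \<open>Fubini with the path fixed and the exponential time integrated out: the section of the
  event is the half-line above the inverse at \<open>t\<close>. The computation uses the version
  \<open>E\<close> measurable on \<open>M\<close>; the inverse itself is reached only at the end,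
  over the completion.\<close>

lemma (in unbounded_subordinator) subordinated_exponential_tail:
  assumes l: "0 < l" and t: "0 \<le> t"
  shows "measure (subordinated (density lborel (exponential_density l))) {t<..} =
    (LINT \<omega>|completion M. exp (- l * inverse_subordinator D t \<omega>))"
proof -
  let ?\<mu> = "density lborel (exponential_density l)"
  interpret \<mu>: real_distribution ?\<mu>
    by (rule real_distribution_exponential[OF l])
  interpret law: real_distribution "subordinated ?\<mu>"
    by (rule real_distribution_subordinated) unfold_locales
  interpret PM: pair_prob_space ?\<mu> M ..
  note m = left_lim_pair_measurable[of ?\<mu>]
  let ?B = "(\<lambda>(x, \<omega>). left_lim (\<lambda>t. D t \<omega>) x) -` {t<..} \<inter> space (?\<mu> \<Otimes>\<^sub>M M)"
  define E where "E \<omega> = ratsup (\<lambda>q. D q \<omega> \<le> t)" for \<omega>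
  have E_meas[measurable]: "E \<in> borel_measurable M"
    unfolding E_def by (rule measurable_ratsup) measurable
  have E_nonneg: "0 \<le> E \<omega>" for \<omega>
    by (simp add: E_def ratsup_def)
  have E_eq: "AE \<omega> in M. inverse_subordinator D t \<omega> = E \<omega>"
    using path
  proof eventually_elim
    case (elim \<omega>)
    show ?case
      unfolding E_def by (rule inverse_subordinator_eq_ratsup[where D=D and \<omega>=\<omega>, OF elim t])
  qed
  have slice: "AE \<omega> in M. (\<lambda>x. (x, \<omega>)) -` ?B = {E \<omega><..}"
    using path E_eq AE_space
  proof eventually_elim
    case (elim \<omega>)
    show ?case
      using le_inverse_subordinator_iff[where D=D and \<omega>=\<omega>, OF elim(1) t] elim(2,3)
      by (auto simp: space_pair_measure not_le[symmetric] simp del: not_le)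
  qed
  have int: "integrable M (\<lambda>\<omega>. exp (- l * E \<omega>))"
    using l E_nonneg by (intro integrable_const_bound[where B=1]) auto
  have B: "?B \<in> sets (?\<mu> \<Otimes>\<^sub>M M)"
    by (rule measurable_sets[OF m]) auto
  have "emeasure (subordinated ?\<mu>) {t<..} = emeasure (?\<mu> \<Otimes>\<^sub>M M) ?B"
    unfolding subordinated_def by (rule emeasure_distr[OF m]) auto
  also have "\<dots> = (\<integral>\<^sup>+\<omega>. emeasure ?\<mu> ((\<lambda>x. (x, \<omega>)) -` ?B) \<partial>M)"
    by (rule PM.emeasure_pair_measure_alt2[OF B])
  also have "\<dots> = (\<integral>\<^sup>+\<omega>. ennreal (exp (- l * E \<omega>)) \<partial>M)"
  proof (rule nn_integral_cong_AE)
    show "AE \<omega> in M. emeasure ?\<mu> ((\<lambda>x. (x, \<omega>)) -` ?B) = ennreal (exp (- l * E \<omega>))"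
      using slice
    proof eventually_elim
      case (elim \<omega>)
      show ?case
        unfolding elim by (rule emeasure_exponential_greaterThan[OF l E_nonneg])
    qed
  qed
  also have "\<dots> = ennreal (LINT \<omega>|M. exp (- l * E \<omega>))"
    using int by (rule nn_integral_eq_integral) simp
  finally have "measure (subordinated ?\<mu>) {t<..} = (LINT \<omega>|M. exp (- l * E \<omega>))"
    by (simp add: law.emeasure_eq_measure Bochner_Integration.integral_nonneg)
  also have "\<dots> = (LINT \<omega>|completion M. exp (- l * E \<omega>))"
    by (rule integral_completion[symmetric]) measurable
  also have "\<dots> = (LINT \<omega>|completion M. exp (- l * inverse_subordinator D t \<omega>))"
  proof (rule integral_cong_AE)
    have E_C[measurable]: "E \<in> borel_measurable (completion M)"
      by (rule measurable_completion[OF E_meas])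
    have "inverse_subordinator D t \<in> borel_measurable (completion M)"
    proof (rule measurableI)
      fix A :: "real set" assume A: "A \<in> sets borel"
      show "inverse_subordinator D t -` A \<inter> space (completion M) \<in> sets (completion M)"
      proof (rule completion.in_sets_AE)
        show "E -` A \<inter> space (completion M) \<in> sets (completion M)"
          using E_C A by (rule measurable_sets)
        show "AE \<omega> in completion M. \<omega> \<in> E -` A \<inter> space (completion M) \<longleftrightarrow>
            \<omega> \<in> inverse_subordinator D t -` A \<inter> space (completion M)"
          using AE_completion[OF E_eq] by eventually_elim simp
      qed simp
    qed simp
    then show "(\<lambda>\<omega>. exp (- l * inverse_subordinator D t \<omega>)) \<in> borel_measurable (completion M)"
      by simp
    show "(\<lambda>\<omega>. exp (- l * E \<omega>)) \<in> borel_measurable (completion M)"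
      by measurable
    show "AE \<omega> in completion M. exp (- l * E \<omega>) = exp (- l * inverse_subordinator D t \<omega>)"
      using AE_completion[OF E_eq] by eventually_elim simp
  qed
  finally show ?thesis .
qed

section \<open>Waiting times of the fractional Poisson process\<close>

lemma renewal_process_cong:
  assumes "\<And>t \<omega>. 0 \<le> t \<Longrightarrow> \<omega> \<in> space M \<Longrightarrow> X t \<omega> = Y t \<omega>" and R: "renewal_process M Y G"
  shows "renewal_process M X G"
proof -
  have "AE \<omega> in M. \<forall>t\<ge>0. finite {n. 1 \<le> n \<and> (\<Sum>k=1..n. G k \<omega>) \<le> t} \<and>
      Y t \<omega> = card {n. 1 \<le> n \<and> (\<Sum>k=1..n. G k \<omega>) \<le> t}"
    using R unfolding renewal_process_def by blast
  then have "AE \<omega> in M. \<forall>t\<ge>0. finite {n. 1 \<le> n \<and> (\<Sum>k=1..n. G k \<omega>) \<le> t} \<and>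
      X t \<omega> = card {n. 1 \<le> n \<and> (\<Sum>k=1..n. G k \<omega>) \<le> t}"
    using AE_space
  proof eventually_elim
    case (elim \<omega>)
    show ?case
    proof (intro allI impI)
      fix t :: real assume "0 \<le> t"
      then show "finite {n. 1 \<le> n \<and> (\<Sum>k=1..n. G k \<omega>) \<le> t} \<and>
          X t \<omega> = card {n. 1 \<le> n \<and> (\<Sum>k=1..n. G k \<omega>) \<le> t}"
        unfolding assms(1)[OF \<open>0 \<le> t\<close> elim(2)] using elim(1) by blast
    qed
  qed
  then show ?thesis
    using R unfolding renewal_process_def by blast
qed

lemma renewal_process_gap_law:
  assumes R: "renewal_process M X G" and n: "1 \<le> n"
  shows "real_distribution (distr M borel (G n))" "AE x in distr M borel (G n). 0 < x"
proof -
  interpret prob_space M using R by (simp add: renewal_process_def)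
  have "indep_vars (\<lambda>_. borel) G {1..}"
    using R unfolding renewal_process_def by (elim conjE)
  then have G: "G n \<in> borel_measurable M"
    using n by (auto simp: indep_vars_def)
  then show "real_distribution (distr M borel (G n))"
    by (rule real_distribution_distr)
  have "AE \<omega> in M. 0 < G n \<omega>"
    using R n unfolding renewal_process_def by blast
  then show "AE x in distr M borel (G n). 0 < x"
    using G by (subst AE_distr_iff) auto
qed

text \<open>For \<beta> < 1, subordination replaces \<open>c\<close> by
  \<open>c powr \<beta>\<close> in the transform \<open>l / (l + c)\<close> of the exponential gaps.
  The value \<open>c = 0\<close> is included because the formula is later evaluated at
  \<open>c = f s\<close>, for which nonnegativity is what is established.\<close>

lemma fractional_poisson_process_renewal:
  assumes F: "fractional_poisson_process M \<beta> l X" and \<beta>: "0 < \<beta>" "\<beta> \<le> 1" and l: "0 < l"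
  shows "\<exists>G. renewal_process M X G \<and>
    (\<forall>c\<ge>0. (LINT x|distr M borel (G 1). exp (- c * x)) = l / (l + c powr \<beta>))"
proof (cases "\<beta> = 1")
  case True
  then have "poisson_process M l X"
    using F by (simp add: fractional_poisson_process_def)
  from poisson_process_renewal[OF this l] obtain G where G: "renewal_process M X G"
    "distributed M lborel (G 1) (exponential_density l)"
    by blast
  have "distr M borel (G 1) = density lborel (exponential_density l)"
    using distributed_distr_eq_density[OF G(2)] by (simp cong: distr_cong)
  then show ?thesis
    using G(1) laplace_exponential[OF l] True by (intro exI[of _ G]) simp
next
  case False
  then obtain N D where N: "poisson_process M l N" and D: "subordinator M (\<lambda>s. s powr \<beta>) D"
    and ind: "indep_processes M (\<lambda>t \<omega>. real (N t \<omega>)) (inverse_subordinator D)"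
    and X: "\<And>t \<omega>. 0 \<le> t \<Longrightarrow> \<omega> \<in> space M \<Longrightarrow> X t \<omega> = N (inverse_subordinator D t \<omega>) \<omega>"
    using F unfolding fractional_poisson_process_def by auto
  interpret unbounded_subordinator M "\<lambda>s. s powr \<beta>" D
    using D \<beta> by unfold_locales (auto intro!: filterlim_compose[OF filterlim_powr_at_top filterlim_real_sequentially])
  obtain G where G: "renewal_process M N G" "distributed M lborel (G 1) (exponential_density l)"
    using poisson_process_renewal[OF N l] by blast
  have law: "distr M borel (G 1) = density lborel (exponential_density l)"
    using distributed_distr_eq_density[OF G(2)] by (simp cong: distr_cong)
  obtain J where J: "renewal_process M (\<lambda>t \<omega>. N (inverse_subordinator D t \<omega>) \<omega>) J"
    "distr M borel (J 1) = subordinated (density lborel (exponential_density l))"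
    using renewal_time_change[OF G(1) ind] unfolding law by blast
  have "(LINT x|distr M borel (J 1). exp (- c * x)) = l / (l + c powr \<beta>)" if "0 \<le> c" for c
  proof (cases "c = 0")
    \<comment> \<open>The subordination formula covers positive arguments only. At
      \<open>c = 0\<close> the integral is the total mass, matching the convention
      \<open>0 powr \<beta> = 0\<close>.\<close>
    case True
    interpret J: real_distribution "distr M borel (J 1)"
      by (rule renewal_process_gap_law[OF J(1)]) simp
    show ?thesis using True l J.prob_space by simp
  next
    case False
    with that have "0 < c" by simp
    show ?thesis
      unfolding J(2) laplace_subordinated[OF real_distribution_exponential[OF l] AE_exponential_pos \<open>0 < c\<close>]
      by (rule laplace_exponential[OF l]) simp
  qed
  then show ?thesis
    using renewal_process_cong[of M X, OF X J(1)] by blast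
qed

theorem theorem4p3:
  fixes M :: "'a measure" and M' :: "'b measure"
    and \<beta> l b :: real and \<nu> :: "real measure" and f :: "real \<Rightarrow> real"
    and N\<^sub>\<beta> :: "real \<Rightarrow> 'a \<Rightarrow> nat"
    and D\<^sub>f :: "real \<Rightarrow> 'a \<Rightarrow> real" and D\<^sub>\<phi> :: "real \<Rightarrow> 'b \<Rightarrow> real"
  assumes "prob_space M" and "prob_space M'"
    and "0 < \<beta>" and "\<beta> \<le> 1" and "0 < l"
    and "0 \<le> b" and "subordinator_levy_measure \<nu>" and "emeasure \<nu> {0<..} = \<infinity>"
    and "\<And>s. 0 < s \<Longrightarrow> f s = bernstein_fun b \<nu> s"
    and "fractional_poisson_process M \<beta> l N\<^sub>\<beta>"
    and "subordinator M f D\<^sub>f"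
    and "indep_processes M (\<lambda>t \<omega>. real (N\<^sub>\<beta> t \<omega>)) (inverse_subordinator D\<^sub>f)"
    and "subordinator M' (\<lambda>s. f s powr \<beta>) D\<^sub>\<phi>"
  shows "\<exists>J. renewal_process M (\<lambda>t \<omega>. N\<^sub>\<beta> (inverse_subordinator D\<^sub>f t \<omega>) \<omega>) J \<and>
           (\<forall>n\<ge>1. \<forall>t\<ge>0. measure M {\<omega> \<in> space M. t < J n \<omega>}
              = (LINT \<omega>|completion M'. exp (- l * inverse_subordinator D\<^sub>\<phi> t \<omega>)))"
proof -
  have f_nonneg: "0 \<le> f s" if "0 < s" for s
    using assms(9)[OF that] bernstein_fun_nonneg[OF assms(7,6), of s] that by simp
  \<comment> \<open>\<open>f\<close> is prescribed at positive arguments only, so the index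
    \<open>k = 0\<close> is excluded.\<close>
  have "\<forall>\<^sub>F k in sequentially. bernstein_fun b \<nu> (real k) = f (real k)"
    using eventually_gt_at_top[of 0] by eventually_elim (simp add: assms(9))
  then have f_top: "filterlim (\<lambda>k. f (real k)) at_top sequentially"
    using bernstein_fun_at_top[OF assms(7,8,6)] by (simp cong: filterlim_cong)
  interpret Df: unbounded_subordinator M f D\<^sub>f
    using assms(11) f_top by unfold_locales
  interpret D\<phi>: unbounded_subordinator M' "\<lambda>s. f s powr \<beta>" D\<^sub>\<phi>
    using assms(13) filterlim_compose[OF filterlim_powr_at_top[OF assms(3)] f_top] by unfold_locales
  obtain G where G: "renewal_process M N\<^sub>\<beta> G"
    "\<And>c. 0 \<le> c \<Longrightarrow> (LINT x|distr M borel (G 1). exp (- c * x)) = l / (l + c powr \<beta>)"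
    using fractional_poisson_process_renewal[OF assms(10,3,4,5)] by blast
  note G_law = renewal_process_gap_law[OF G(1) order_refl]
  obtain J where J: "renewal_process M (\<lambda>t \<omega>. N\<^sub>\<beta> (inverse_subordinator D\<^sub>f t \<omega>) \<omega>) J"
    "\<And>n. 1 \<le> n \<Longrightarrow> distr M borel (J n) = Df.subordinated (distr M borel (G 1))"
    using Df.renewal_time_change[OF G(1) assms(12)] by blast
  let ?\<mu> = "density lborel (exponential_density l)"
  note \<mu>_law = real_distribution_exponential[OF assms(5)] AE_exponential_pos[of l]
  \<comment> \<open>One side evaluates the transform of the gaps of \<open>N\<^sub>\<beta>\<close>
    at \<open>f s\<close>, the other the transform of the exponential law at
    \<open>f s powr \<beta>\<close>. The two laws come from different probability spaces and meet
    only in this equality.\<close>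
  have eq: "Df.subordinated (distr M borel (G 1)) = D\<phi>.subordinated ?\<mu>"
  proof (rule real_distribution_eqI_laplace)
    show "real_distribution (Df.subordinated (distr M borel (G 1)))"
      by (rule Df.real_distribution_subordinated[OF G_law(1)])
    show "real_distribution (D\<phi>.subordinated ?\<mu>)"
      by (rule D\<phi>.real_distribution_subordinated[OF \<mu>_law(1)])
    show "AE x in Df.subordinated (distr M borel (G 1)). 0 \<le> x"
      using Df.AE_subordinated_pos[OF G_law] by eventually_elim simp
    show "AE x in D\<phi>.subordinated ?\<mu>. 0 \<le> x"
      using D\<phi>.AE_subordinated_pos[OF \<mu>_law] by eventually_elim simp
    fix s :: real assume s: "0 < s"
    have "(LINT x|Df.subordinated (distr M borel (G 1)). exp (- s * x)) = l / (l + f s powr \<beta>)"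
      unfolding Df.laplace_subordinated[OF G_law s] by (rule G(2)[OF f_nonneg[OF s]])
    moreover have "(LINT x|D\<phi>.subordinated ?\<mu>. exp (- s * x)) = l / (l + f s powr \<beta>)"
      unfolding D\<phi>.laplace_subordinated[OF \<mu>_law s] by (rule laplace_exponential[OF assms(5)]) simp
    ultimately show "(LINT x|Df.subordinated (distr M borel (G 1)). exp (- s * x)) =
        (LINT x|D\<phi>.subordinated ?\<mu>. exp (- s * x))"
      by simp
  qed
  have "measure M {\<omega> \<in> space M. t < J n \<omega>} =
      (LINT \<omega>|completion M'. exp (- l * inverse_subordinator D\<^sub>\<phi> t \<omega>))" if n: "1 \<le> n" and t: "0 \<le> t" for n t
  proof -
    have "J n \<in> borel_measurable M"
      using J(1) n unfolding renewal_process_def Df.indep_vars_def by auto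
    then have "measure M {\<omega> \<in> space M. t < J n \<omega>} = measure (distr M borel (J n)) {t<..}"
      by (subst measure_distr) (auto intro!: arg_cong[where f="measure M"])
    then show ?thesis
      unfolding J(2)[OF n] eq D\<phi>.subordinated_exponential_tail[OF assms(5) t] .
  qed
  with J(1) show ?thesis by blast
qed

end
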